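(* Let $r\ge1$, let $b_1,\dots,b_r\in\mathbb Z^2$ be nonzero and $c_1,c_2\in\mathbb Z^2$ with $\det(c_1,c_2)\ne0$, such that $b_1,\dots,b_r,c_1,c_2$ span the lattice $\mathbb Z^2$. Let $B$ be the $(2r+3)\times 2$ integer matrix with rows $b_1,\dots,b_r,c_1,c_2,-b_1,\dots,-b_r,-c_1-c_2$, and let $A$ be a $(2r+1)\times(2r+3)$ integer matrix of rank $2r+1$ with columns $a_1,\dots,a_{2r+3}$, such that some rational vector $w$ satisfies $w\cdot a_k=1$ for all $k$ and the columns of $B$ form a $\mathbb Z$-basis of $\ker_{\mathbb Z}(A)$. Let $\Gamma=|\det(c_1,c_2)|$. Then the number of terms (monomials with nonzero coefficient) of the $A$-discriminant $D_A$ is at most $\frac54\Gamma+\frac74$.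
   Context: $\det(b,u)=b_1u_2-b_2u_1$. A-discriminant: for $X\in(\mathbb C^* )^{2r+3}$ let $f=\sum_k X_k s^{a_k}$ (Laurent polynomial in $2r+1$ variables $s$). If the closure of the set of $X$ for which $f$ has a multiple root in the torus $(\mathbb C^* )^{2r+1}$ is a hypersurface, $D_A$ is its irreducible defining polynomial in $\mathbb Z[X_1,\dots,X_{2r+3}]$; otherwise $D_A=1$. (Such $A$ arise from the Cayley trick, and $D_A$ is then the sparse resultant of $r$ binomials and one trinomial.) *)

theory Defs
  imports Complex_Main "HOL-Library.Product_Plus" "HOL-Library.Poly_Mapping" "HOL-Computational_Algebra.Factorial_Ring"
begin

text \<open>Multivariate polynomials in the variables X_0, X_1, ... (index i stands for the
  paper's X_(i+1)) with coefficients in 'a: finitely supported maps from monomials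
  (finitely supported exponent vectors) to coefficients.\<close>
type_synonym 'a mpoly = "(nat \<Rightarrow>\<^sub>0 nat) \<Rightarrow>\<^sub>0 'a"

definition mpoly_vars_in :: "nat \<Rightarrow> 'a::zero mpoly \<Rightarrow> bool" where
  "mpoly_vars_in N P \<longleftrightarrow> (\<forall>m\<in>Poly_Mapping.keys P. Poly_Mapping.keys m \<subseteq> {..<N})"

definition mpoly_eval :: "'a::comm_ring_1 mpoly \<Rightarrow> (nat \<Rightarrow> 'a) \<Rightarrow> 'a" where
  "mpoly_eval P X = (\<Sum>m\<in>Poly_Mapping.keys P. Poly_Mapping.lookup P m * (\<Prod>i\<in>Poly_Mapping.keys m. X i ^ Poly_Mapping.lookup m i))"

definition mpoly_map_int :: "int mpoly \<Rightarrow> complex mpoly" where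
  "mpoly_map_int P = Poly_Mapping.map of_int P"

definition num_terms :: "'a::zero mpoly \<Rightarrow> nat" where
  "num_terms P = card (Poly_Mapping.keys P)"

definition pts :: "nat \<Rightarrow> (nat \<Rightarrow> complex) set" where
  "pts N = {X. \<forall>k\<ge>N. X k = 0}"

definition zariski_closure :: "nat \<Rightarrow> (nat \<Rightarrow> complex) set \<Rightarrow> (nat \<Rightarrow> complex) set" where
  "zariski_closure N S = {X\<in>pts N. \<forall>Q::complex mpoly. mpoly_vars_in N Q \<longrightarrow>
       (\<forall>Y\<in>S. mpoly_eval Q Y = 0) \<longrightarrow> mpoly_eval Q X = 0}"

definition laurent_f :: "nat \<Rightarrow> nat \<Rightarrow> (nat \<Rightarrow> nat \<Rightarrow> int) \<Rightarrow> (nat \<Rightarrow> complex) \<Rightarrow> (nat \<Rightarrow> complex) \<Rightarrow> complex" where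
  "laurent_f n N A X s = (\<Sum>k<N. X k * (\<Prod>i<n. s i powi A i k))"

definition laurent_f_deriv :: "nat \<Rightarrow> nat \<Rightarrow> (nat \<Rightarrow> nat \<Rightarrow> int) \<Rightarrow> nat \<Rightarrow> (nat \<Rightarrow> complex) \<Rightarrow> (nat \<Rightarrow> complex) \<Rightarrow> complex" where
  "laurent_f_deriv n N A j X s =
     (\<Sum>k<N. X k * of_int (A j k) * (\<Prod>i<n. s i powi (A i k - (if i = j then 1 else 0))))"

definition disc_set :: "nat \<Rightarrow> nat \<Rightarrow> (nat \<Rightarrow> nat \<Rightarrow> int) \<Rightarrow> (nat \<Rightarrow> complex) set" where
  "disc_set n N A = {X\<in>pts N. (\<forall>k<N. X k \<noteq> 0) \<and>
      (\<exists>s. (\<forall>i<n. s i \<noteq> 0) \<and> laurent_f n N A X s = 0 \<and>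
           (\<forall>j<n. laurent_f_deriv n N A j X s = 0))}"

definition is_A_disc_poly :: "nat \<Rightarrow> nat \<Rightarrow> (nat \<Rightarrow> nat \<Rightarrow> int) \<Rightarrow> int mpoly \<Rightarrow> bool" where
  "is_A_disc_poly n N A P \<longleftrightarrow> mpoly_vars_in N P \<and> irreducible P \<and> (\<exists>m\<in>Poly_Mapping.keys P. m \<noteq> 0) \<and>
     {X\<in>pts N. mpoly_eval (mpoly_map_int P) X = 0} = zariski_closure N (disc_set n N A)"

text \<open>The A-discriminant D_A (determined up to sign; 1 if there is no such hypersurface).\<close>
definition A_discriminant :: "nat \<Rightarrow> nat \<Rightarrow> (nat \<Rightarrow> nat \<Rightarrow> int) \<Rightarrow> int mpoly" where
  "A_discriminant n N A = (if \<exists>P. is_A_disc_poly n N A P then SOME P. is_A_disc_poly n N A P else 1)"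

definition zsmult2 :: "int \<Rightarrow> int \<times> int \<Rightarrow> int \<times> int" where
  "zsmult2 k v = (k * fst v, k * snd v)"

definition det2 :: "int \<times> int \<Rightarrow> int \<times> int \<Rightarrow> int" where
  "det2 b u = fst b * snd u - snd b * fst u"

text \<open>Rows of B (0-based row index k < 2r+3):
  b_1..b_r, c_1, c_2, -b_1..-b_r, -c_1-c_2; b is indexed 1..r.\<close>
definition B_row :: "nat \<Rightarrow> (nat \<Rightarrow> int \<times> int) \<Rightarrow> int \<times> int \<Rightarrow> int \<times> int \<Rightarrow> nat \<Rightarrow> int \<times> int" where
  "B_row r b c1 c2 k =
     (if k < r then b (k + 1)
      else if k = r then c1
      else if k = r + 1 then c2
      else if k < 2 * r + 2 then - b (k - r - 1)
      else - c1 - c2)"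

end

theory Submission
  imports Defs "Jordan_Normal_Form.Char_Poly"
begin

text \<open>Put \<open>x = \<langle>c1, t\<rangle>\<close> and \<open>y = \<langle>c2, t\<rangle>\<close>. In the Horn--Kapranov parametrization
  \<open>X k = \<langle>B k, t\<rangle> s\<^sup>-\<^sup>a\<close> of the discriminant locus the rows \<open>b k\<close> and \<open>- b k\<close> cancel up to sign, so
  that every \<open>A\<close>-homogeneous component of a polynomial vanishing on the locus becomes a polynomial
  \<open>F\<close> in \<open>x, y\<close> that vanishes on the line \<open>x + y + 1 = 0\<close> and whose exponents lie in one coset of the
  lattice \<open>Lam = {(\<langle>c1, m\<rangle>, \<langle>c2, m\<rangle>)}\<close> of index \<open>\<Gamma>\<close>. By the action of the \<open>\<Gamma>\<close> characters of
  \<open>\<int>\<^sup>2 / Lam\<close>, \<open>F\<close> vanishes on \<open>\<Gamma>\<close> translates of the line and is a multiple of the norm of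
  \<open>x + y + 1\<close>, the determinant of the group matrix of \<open>\<int>\<^sup>2 / Lam\<close>. Lifting back,
  the homogenized norm divides a monomial multiple of the discriminant, so by irreducibility both have
  equally many terms. The norm has integer coefficients and its exponents lie in \<open>Lam\<close> and in the
  triangle \<open>i + j \<le> \<Gamma>\<close>. If \<open>\<alpha>, \<beta>, \<gamma>\<close> are the lattice lengths of the three edges of
  the triangle, it contains \<open>(\<Gamma> + \<alpha> + \<beta> + \<gamma> + 2) / 2\<close> lattice points, and pairwise
  products of edge lengths are at most \<open>\<Gamma>\<close>, whence pairwise sums are at most \<open>\<Gamma> + 1\<close>.\<close>

section \<open>Lattice points in the triangle\<close>

text \<open>Every sublattice of full rank in Z^2 has a basis (d, 0), (e, g). This triangular form
  makes coset representatives and characters of the quotient explicit; \<open>e\<close> need not be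
  reduced modulo \<open>d\<close>.\<close>

locale hermite_lattice =
  fixes d g :: nat and e :: int
  assumes d_pos: "d > 0" and g_pos: "g > 0"
begin

definition idx :: nat where "idx = d * g"

definition Lam :: "(int \<times> int) set" where
  "Lam = range (\<lambda>(a, b). (int d * a + e * b, int g * b))"

definition triangle :: "(int \<times> int) set" where
  "triangle = {v \<in> Lam. 0 \<le> fst v \<and> 0 \<le> snd v \<and> fst v + snd v \<le> int idx}"

lemma idx_pos: "idx > 0"
  using d_pos g_pos by (simp add: idx_def)

lemma LamI: "i = int d * a + e * b \<Longrightarrow> j = int g * b \<Longrightarrow> (i, j) \<in> Lam"
  unfolding Lam_def by (auto intro!: image_eqI[where x = "(a, b)"])

lemma LamE:
  assumes "v \<in> Lam"
  obtains a b where "v = (int d * a + e * b, int g * b)"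
  using assms unfolding Lam_def by auto

lemma Lam_zero: "0 \<in> Lam"
  unfolding zero_prod_def by (rule LamI[where a = 0 and b = 0]) auto

lemma Lam_diff: "u \<in> Lam \<Longrightarrow> v \<in> Lam \<Longrightarrow> u - v \<in> Lam"
proof (elim LamE)
  fix a b a' b'
  assume "u = (int d * a + e * b, int g * b)" "v = (int d * a' + e * b', int g * b')"
  then show "u - v \<in> Lam"
    by (auto simp: algebra_simps intro!: LamI[where a = "a - a'" and b = "b - b'"])
qed

lemma Lam_uminus: "v \<in> Lam \<Longrightarrow> - v \<in> Lam"
  using Lam_diff[OF Lam_zero, of v] by (simp only: diff_0)

lemma Lam_add: "u \<in> Lam \<Longrightarrow> v \<in> Lam \<Longrightarrow> u + v \<in> Lam"
  using Lam_diff[OF _ Lam_uminus, of u v] by (simp only: diff_minus_eq_add)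

lemma Lam_idx_fst: "(int idx, 0) \<in> Lam"
  by (rule LamI[where a = "int g" and b = 0]) (auto simp: idx_def)

lemma Lam_idx_snd: "(0, int idx) \<in> Lam"
  by (rule LamI[where a = "- e" and b = "int d"]) (auto simp: idx_def)

lemma finite_triangle: "finite triangle"
  by (rule finite_subset[of _ "{0..int idx} \<times> {0..int idx}"]) (auto simp: triangle_def)

text \<open>The half-open square is a fundamental domain for \<open>idx\<close> Z^2, so its lattice
  points represent the quotient of \<open>Lam\<close> by \<open>idx\<close> Z^2.\<close>

definition cell :: "(int \<times> int) set" where
  "cell = Lam \<inter> ({0..<int idx} \<times> {0..<int idx})"

lemma finite_cell: "finite cell"
  unfolding cell_def by auto

text \<open>The second coordinate g b leaves d choices of b. It also fixes the residue of the first
  coordinate modulo d, so only g possible quotients k remain.\<close>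

lemma card_cell_le: "card cell \<le> idx"
proof -
  let ?f = "\<lambda>(b, k). ((e * b) mod int d + int d * k, int g * b)"
  have "cell \<subseteq> ?f ` ({0..<int d} \<times> {0..<int g})"
  proof
    fix v assume "v \<in> cell"
    then obtain a b where v: "v = (int d * a + e * b, int g * b)"
      by (auto simp: cell_def elim!: LamE)
    with \<open>v \<in> cell\<close> have bd: "0 \<le> int d * a + e * b" "int d * a + e * b < int d * int g"
      "0 \<le> int g * b" "int g * b < int g * int d"
      by (auto simp: cell_def idx_def mult.commute)
    define k where "k = (int d * a + e * b) div int d"
    have "b \<in> {0..<int d}" using bd(3,4) g_pos by (auto simp: zero_le_mult_iff mult_less_cancel_left)
    moreover have "k \<in> {0..<int g}"
    proof -
      have "int d * k \<le> int d * a + e * b"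
        using mult_div_mod_eq[of "int d" "int d * a + e * b"]
          pos_mod_sign[of "int d" "int d * a + e * b"] d_pos unfolding k_def by linarith
      then have "int d * k < int d * int g" using bd(2) by linarith
      moreover have "0 \<le> k" unfolding k_def using bd(1) d_pos by (intro pos_imp_zdiv_nonneg_iff[THEN iffD2]) auto
      ultimately show ?thesis using d_pos by (simp add: mult_less_cancel_left_pos)
    qed
    moreover have "(e * b) mod int d + int d * k = int d * a + e * b"
    proof -
      have "(e * b) mod int d = (int d * a + e * b) mod int d" by simp
      then show ?thesis unfolding k_def by (metis mod_mult_div_eq)
    qed
    ultimately show "v \<in> ?f ` ({0..<int d} \<times> {0..<int g})"
      unfolding v by (intro image_eqI[where x = "(b, k)"]) auto
  qed
  then have "card cell \<le> card ({0..<int d} \<times> {0..<int g})"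
    by (meson surj_card_le finite_SigmaI finite_atLeastLessThan_int)
  then show ?thesis by (simp add: idx_def card_cartesian_product)
qed

text \<open>All three vertices of the triangle lie in \<open>Lam\<close>, so for each of its edge
  directions the half-open range makes the cardinality the lattice length of that edge.\<close>

definition edge :: "int \<times> int \<Rightarrow> int set" where
  "edge w = {i \<in> {0..<int idx}. (i * fst w, i * snd w) \<in> Lam}"

lemma finite_edge: "finite (edge w)"
  by (rule finite_subset[of _ "{0..<int idx}"]) (auto simp: edge_def)

lemma card_edge_pos: "card (edge w) \<ge> 1"
proof -
  have "0 \<in> edge w"
    using Lam_zero idx_pos by (auto simp: edge_def zero_prod_def)
  then have "card (edge w) \<noteq> 0" using finite_edge by auto
  then show ?thesis by linarith
qed

lemma Lam_mod:
  assumes "(i, j) \<in> Lam" shows "(i mod int idx, j mod int idx) \<in> Lam"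
proof -
  obtain a b where ab: "i = int d * a + e * b" "j = int g * b" using assms by (auto elim: LamE)
  have "i mod int idx = i - int idx * (i div int idx)" "j mod int idx = j - int idx * (j div int idx)"
    by (simp_all add: minus_mult_div_eq_mod)
  then show ?thesis
    by (intro LamI[where a = "a - int g * (i div int idx) + e * (j div int idx)"
          and b = "b - int d * (j div int idx)"])
      (simp_all add: ab idx_def algebra_simps)
qed

text \<open>Since u, w form a basis of Z^2, reducing s u + t w modulo \<open>idx\<close> is
  injective on the pairs (s, t) considered, and it lands in \<open>cell\<close>, which has at most
  \<open>idx\<close> elements.\<close>

lemma card_edge_mult_le:
  assumes det: "det2 u w = 1 \<or> det2 u w = -1"
  shows "card (edge u) * card (edge w) \<le> idx"
proof -
  let ?n = "int idx"
  let ?f = "\<lambda>(s, t). ((s * fst u + t * fst w) mod ?n, (s * snd u + t * snd w) mod ?n)"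
  have "inj_on ?f (edge u \<times> edge w)"
  proof -
    have "s = s' \<and> t = t'" if st: "s \<in> edge u" "t \<in> edge w" "s' \<in> edge u" "t' \<in> edge w"
      and eq: "(s * fst u + t * fst w) mod ?n = (s' * fst u + t' * fst w) mod ?n"
        "(s * snd u + t * snd w) mod ?n = (s' * snd u + t' * snd w) mod ?n"
      for s t s' t'
    proof -
      have d1: "?n dvd (s - s') * fst u + (t - t') * fst w"
        using eq(1) unfolding mod_eq_dvd_iff by (simp add: algebra_simps)
      have d2: "?n dvd (s - s') * snd u + (t - t') * snd w"
        using eq(2) unfolding mod_eq_dvd_iff by (simp add: algebra_simps)
      \<comment> \<open>Cramer's rule: this combination eliminates t - t' and leaves the
        determinant, a unit.\<close>
      have "?n dvd ((s - s') * fst u + (t - t') * fst w) * snd w - ((s - s') * snd u + (t - t') * snd w) * fst w"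
        using d1 d2 by (meson dvd_diff dvd_mult2)
      then have "?n dvd (s - s') * det2 u w" by (simp add: det2_def algebra_simps)
      then have "?n dvd s - s'" using det by (metis mult_minus1_right dvd_minus_iff mult.right_neutral)
      moreover have "?n dvd ((s - s') * snd u + (t - t') * snd w) * fst u - ((s - s') * fst u + (t - t') * fst w) * snd u"
        using d1 d2 by (meson dvd_diff dvd_mult2)
      then have "?n dvd (t - t') * det2 u w" by (simp add: det2_def algebra_simps)
      then have "?n dvd t - t'" using det by (metis mult_minus1_right dvd_minus_iff mult.right_neutral)
      moreover have "s mod ?n = s" "s' mod ?n = s'" "t mod ?n = t" "t' mod ?n = t'"
        using st by (auto simp: edge_def)
      ultimately show ?thesis by (metis mod_eq_dvd_iff)
    qed
    then show ?thesis by (auto simp: inj_on_def)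
  qed
  moreover have "?f ` (edge u \<times> edge w) \<subseteq> cell"
  proof (rule image_subsetI, elim SigmaE)
    fix x s t assume x: "x = (s, t)" and "s \<in> edge u" "t \<in> edge w"
    then have "(s * fst u, s * snd u) + (t * fst w, t * snd w) \<in> Lam"
      by (intro Lam_add) (auto simp: edge_def)
    then show "?f x \<in> cell"
      unfolding x using Lam_mod idx_pos by (auto simp: cell_def)
  qed
  ultimately have "card (edge u \<times> edge w) \<le> card cell"
    using card_inj_on_le finite_cell by blast
  then show ?thesis using card_cell_le by (simp add: card_cartesian_product)
qed

text \<open>For x, y >= 1, the inequality (x - 1)(y - 1) >= 0 gives x + y <= xy + 1.\<close>

lemma card_edge_add_le:
  assumes "det2 u w = 1 \<or> det2 u w = -1"
  shows "card (edge u) + card (edge w) \<le> idx + 1"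
proof -
  obtain x y where "card (edge u) = Suc x" "card (edge w) = Suc y"
    using card_edge_pos[of u] card_edge_pos[of w]
    by (metis One_nat_def Suc_le_D)
  then show ?thesis using card_edge_mult_le[OF assms] by simp
qed

text \<open>The triangle and its image under \<open>v \<mapsto> (idx, idx) - v\<close> cover the closed square and
  meet in the hypotenuse, and the closed square is the half-open cell plus two edges.\<close>

lemma card_triangle_le:
  "2 * card triangle \<le> idx + card (edge (1, 0)) + card (edge (0, 1)) + card (edge (1, -1)) + 2"
proof -
  let ?n = "int idx"
  define T' where "T' = (\<lambda>v. (?n, ?n) - v) ` triangle"
  have nn: "(?n, ?n) \<in> Lam" using Lam_add[OF Lam_idx_fst Lam_idx_snd] by simp
  have cT': "card T' = card triangle"
    unfolding T'_def by (rule card_image) (auto simp: inj_on_def prod_eq_iff)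
  have finT': "finite T'" unfolding T'_def using finite_triangle by auto
  have T': "v \<in> Lam \<and> fst v \<le> ?n \<and> snd v \<le> ?n \<and> fst v + snd v \<ge> ?n" if "v \<in> T'" for v
  proof -
    obtain w where w: "w \<in> triangle" "v = (?n, ?n) - w" using \<open>v \<in> T'\<close> unfolding T'_def by blast
    then show ?thesis using Lam_diff[OF nn, of w] by (simp add: triangle_def)
  qed
  have "triangle \<union> T' \<subseteq> insert (?n, ?n) (cell \<union> (\<lambda>i. (i, ?n)) ` edge (1, 0) \<union> (\<lambda>j. (?n, j)) ` edge (0, 1))"
    (is "_ \<subseteq> ?U")
  proof
    fix v assume v: "v \<in> triangle \<union> T'"
    have "v \<in> Lam \<and> 0 \<le> fst v \<and> fst v \<le> ?n \<and> 0 \<le> snd v \<and> snd v \<le> ?n"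
    proof (cases "v \<in> T'")
      case True
      then show ?thesis using T'[OF True] by simp
    next
      case False
      then have "v \<in> triangle" using v by blast
      then show ?thesis by (simp add: triangle_def)
    qed
    then have L: "v \<in> Lam" and b: "0 \<le> fst v" "fst v \<le> ?n" "0 \<le> snd v" "snd v \<le> ?n"
      by blast+
    have h1: "snd v = ?n \<Longrightarrow> (fst v, 0) \<in> Lam"
      using Lam_diff[OF L Lam_idx_snd] by (simp add: minus_prod_def)
    have h2: "fst v = ?n \<Longrightarrow> (0, snd v) \<in> Lam"
      using Lam_diff[OF L Lam_idx_fst] by (simp add: minus_prod_def)
    consider "fst v < ?n" "snd v < ?n" | "fst v < ?n" "snd v = ?n" | "fst v = ?n" "snd v < ?n"
      | "fst v = ?n" "snd v = ?n" using b by linarith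
    then show "v \<in> ?U"
    proof cases
      case 1 then show ?thesis using L b by (auto simp: cell_def mem_Times_iff)
    next
      case 2 then show ?thesis using h1 b
        by (auto simp: edge_def prod_eq_iff intro!: image_eqI[where x = "fst v"])
    next
      case 3 then show ?thesis using h2 b
        by (auto simp: edge_def prod_eq_iff intro!: image_eqI[where x = "snd v"])
    next
      case 4 then show ?thesis by (auto simp: prod_eq_iff)
    qed
  qed
  moreover have finU: "finite ?U" using finite_cell finite_edge by auto
  ultimately have "card (triangle \<union> T') \<le> card ?U" by (rule card_mono[rotated])
  also have "\<dots> \<le> Suc (card (cell \<union> (\<lambda>i. (i, ?n)) ` edge (1, 0) \<union> (\<lambda>j. (?n, j)) ` edge (0, 1)))"
    by (rule card_insert_le_m1) auto
  also have "\<dots> \<le> Suc (card cell + card (edge (1, 0)) + card (edge (0, 1)))"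
    using card_Un_le[of "cell \<union> (\<lambda>i. (i, ?n)) ` edge (1, 0)" "(\<lambda>j. (?n, j)) ` edge (0, 1)"]
      card_Un_le[of cell "(\<lambda>i. (i, ?n)) ` edge (1, 0)"]
      card_image_le[OF finite_edge, of "\<lambda>i. (i, ?n)" "(1, 0)"]
      card_image_le[OF finite_edge, of "\<lambda>j. (?n, j)" "(0, 1)"] by linarith
  finally have union: "card (triangle \<union> T') \<le> Suc (idx + card (edge (1, 0)) + card (edge (0, 1)))"
    using card_cell_le by linarith
  \<comment> \<open>The half-open edge omits the end point (idx, 0), hence the extra 1.\<close>
  have "triangle \<inter> T' \<subseteq> insert (?n, 0) ((\<lambda>i. (i, ?n - i)) ` edge (1, -1))" (is "_ \<subseteq> ?V")
  proof
    fix v assume v: "v \<in> triangle \<inter> T'"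
    then have "v \<in> triangle" "v \<in> T'" by auto
    then have L: "v \<in> Lam" and b: "0 \<le> fst v" "fst v \<le> ?n" "snd v = ?n - fst v"
      using T'[of v] by (simp_all add: triangle_def)
    have "(fst v, - fst v) \<in> Lam"
      using Lam_diff[OF L Lam_idx_snd] b(3) by (simp add: minus_prod_def)
    then show "v \<in> ?V" using b
      by (cases "fst v = ?n") (auto simp: edge_def prod_eq_iff intro!: image_eqI[where x = "fst v"])
  qed
  then have "card (triangle \<inter> T') \<le> card ?V" using finite_edge by (intro card_mono) auto
  also have "\<dots> \<le> Suc (card (edge (1, -1)))"
    using card_insert_le_m1 card_image_le[OF finite_edge] 
    by (metis (no_types, lifting) card_insert_if finite_edge finite_imageI le_SucI not_less_eq_eq)
  finally have inter: "card (triangle \<inter> T') \<le> Suc (card (edge (1, -1)))" .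
  have "card triangle + card T' = card (triangle \<union> T') + card (triangle \<inter> T')"
    using card_Un_Int finite_triangle finT' by blast
  then show ?thesis using union inter cT' by linarith
qed

text \<open>Adding the three pairwise bounds shows that twice the sum of the edge lengths is at most
  3 idx + 3; doubling \<open>card_triangle_le\<close> then gives 4 card <= 5 idx + 7.\<close>

lemma card_triangle: "real (card triangle) \<le> 5/4 * real idx + 7/4"
proof -
  have "card (edge (1, 0)) + card (edge (0, 1)) \<le> idx + 1"
    "card (edge (1, 0)) + card (edge (1, -1)) \<le> idx + 1"
    "card (edge (0, 1)) + card (edge (1, -1)) \<le> idx + 1"
    by (rule card_edge_add_le; simp add: det2_def)+
  then have "4 * card triangle \<le> 5 * idx + 7" using card_triangle_le by linarith
  then show ?thesis by linarith
qed

section \<open>Representatives of the cosets\<close>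

definition rep :: "nat \<Rightarrow> int \<times> int" where
  "rep k = (int (k mod d), int (k div d))"

text \<open>The basis is triangular: division by \<open>g\<close> in the second coordinate fixes b,
  after which division by \<open>d\<close> fixes the first coordinate. Uniqueness compares
  coordinates in the same order.\<close>

lemma rep_ex1: "\<exists>!k. k < idx \<and> v - rep k \<in> Lam"
proof -
  define b where "b = snd v div int g"
  define j where "j = snd v mod int g"
  define i where "i = (fst v - e * b) mod int d"
  define k where "k = nat (i + int d * j)"
  have ij: "0 \<le> i" "i < int d" "0 \<le> j" "j < int g" using d_pos g_pos by (auto simp: i_def j_def)
  have ik: "int k = i + int d * j" using ij by (simp add: k_def)
  have rk: "rep k = (i, j)"
    using ij ik d_pos by (simp add: rep_def zdiv_int zmod_int)
  have "int d * j \<le> int d * (int g - 1)" using ij by (intro mult_left_mono) auto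
  then have "int k < int d * int g" using ij ik by (simp add: algebra_simps)
  then have "k < idx" unfolding idx_def by (metis of_nat_less_iff of_nat_mult)
  moreover have "v - rep k \<in> Lam"
  proof -
    have "fst v - i = int d * ((fst v - e * b) div int d) + e * b"
      using minus_mod_eq_mult_div[of "fst v - e * b" "int d"] by (simp add: i_def)
    moreover have "snd v - j = int g * b" by (simp add: j_def b_def minus_mod_eq_mult_div)
    ultimately show ?thesis unfolding rk by (metis LamI minus_prod_def fst_conv snd_conv)
  qed
  moreover have "k' = k" if "k' < idx" "v - rep k' \<in> Lam" for k'
  proof -
    have "(v - rep k) - (v - rep k') \<in> Lam" using that \<open>v - rep k \<in> Lam\<close> Lam_diff by blast
    then have "rep k' - rep k \<in> Lam" by simp
    then obtain a c where ac: "int (k' mod d) - i = int d * a + e * c" "int (k' div d) - j = int g * c"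
      unfolding rk by (auto simp: rep_def elim!: LamE)
    have "k' div d < g" using that(1) unfolding idx_def
      by (metis less_mult_imp_div_less mult.commute)
    then have "int (k' div d) mod int g = int (k' div d)" "j mod int g = j"
      using ij by auto
    moreover have "int (k' div d) mod int g = j mod int g"
      unfolding mod_eq_dvd_iff ac by simp
    ultimately have jj: "int (k' div d) = j" by argo
    then have "int g * c = 0" using ac(2) by linarith
    then have "c = 0" using g_pos by simp
    then have "int (k' mod d) mod int d = i mod int d"
      unfolding mod_eq_dvd_iff ac by simp
    then have "int (k' mod d) = i" using ij by (simp add: zmod_int)
    then have "int k' = i + int d * j" using jj
      by (metis mod_mult_div_eq of_nat_add of_nat_mult)
    then show "k' = k" using ik by simp
  qed
  ultimately show ?thesis by blast
qed

end

text \<open>With (p, q) = c2 / G and Bezout coefficients (x, y), the vectors (x, y) and (q, -p) form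
  a basis of Z^2. Pairing them with c1 and c2 gives (e, G) and (D, 0), and D G is the
  determinant.\<close>

lemma hermite_normal_form:
  assumes det: "det2 c1 c2 \<noteq> 0"
  obtains d g e where "d > 0" "g > 0" "int (d * g) = \<bar>det2 c1 c2\<bar>"
    "\<And>v. v \<in> hermite_lattice.Lam d g e \<longleftrightarrow>
       (\<exists>m. v = (fst c1 * fst m + snd c1 * snd m, fst c2 * fst m + snd c2 * snd m))"
proof -
  define G where "G = gcd (fst c2) (snd c2)"
  have G: "G > 0" using det by (auto simp: G_def det2_def)
  obtain x y where xy: "x * fst c2 + y * snd c2 = G"
    using bezout_int[of "fst c2" "snd c2"] unfolding G_def by blast
  define p where "p = fst c2 div G"
  define q where "q = snd c2 div G"
  have pq: "fst c2 = G * p" "snd c2 = G * q" by (auto simp: p_def q_def G_def)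
  have "G * (x * p + y * q) = G * 1" using xy pq by (simp add: algebra_simps)
  then have unit: "x * p + y * q = 1" using G by (metis mult_cancel_left less_irrefl)
  define D where "D = fst c1 * q - snd c1 * p"
  have DG: "D * G = det2 c1 c2" by (simp add: D_def det2_def pq algebra_simps)
  have D: "D \<noteq> 0" using DG det by auto
  \<comment> \<open>The sign turns (D, 0) into a basis vector with positive first entry, as the
    locale requires.\<close>
  define s where "s = sgn D"
  have s: "s * s = 1" "s * D = \<bar>D\<bar>" using D by (auto simp: s_def sgn_if)
  define e where "e = fst c1 * x + snd c1 * y"
  interpret hermite_lattice "nat \<bar>D\<bar>" "nat G" e
    using D G by unfold_locales auto
  have "v \<in> Lam \<longleftrightarrow> (\<exists>m. v = (fst c1 * fst m + snd c1 * snd m, fst c2 * fst m + snd c2 * snd m))" for v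
  proof
    assume "v \<in> Lam"
    then obtain a b where v: "v = (\<bar>D\<bar> * a + e * b, G * b)"
      using G D by (elim LamE) (metis abs_ge_zero less_imp_le int_nat_eq)
    have "\<bar>D\<bar> * a + e * b = fst c1 * (x * b + q * s * a) + snd c1 * (y * b - p * s * a)"
      unfolding s(2)[symmetric] by (simp add: D_def e_def algebra_simps)
    moreover have "G * b = fst c2 * (x * b + q * s * a) + snd c2 * (y * b - p * s * a)"
    proof -
      have "fst c2 * (x * b + q * s * a) + snd c2 * (y * b - p * s * a) = G * b * (x * p + y * q)"
        by (simp add: pq algebra_simps)
      then show ?thesis by (simp add: unit)
    qed
    ultimately show "\<exists>m. v = (fst c1 * fst m + snd c1 * snd m, fst c2 * fst m + snd c2 * snd m)"
      unfolding v by (intro exI[where x = "(x * b + q * s * a, y * b - p * s * a)"]) auto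
  next
    assume "\<exists>m. v = (fst c1 * fst m + snd c1 * snd m, fst c2 * fst m + snd c2 * snd m)"
    then obtain m where v: "v = (fst c1 * fst m + snd c1 * snd m, fst c2 * fst m + snd c2 * snd m)" ..
    \<comment> \<open>\<open>b\<close> and \<open>a\<close> are the coordinates of m in the basis
      (x, y), s (q, -p).\<close>
    define b where "b = p * fst m + q * snd m"
    define a where "a = s * (y * fst m - x * snd m)"
    have "\<bar>D\<bar> * a = (s * s) * D * (y * fst m - x * snd m)" unfolding s(2)[symmetric] a_def by simp
    then have "\<bar>D\<bar> * a + e * b = (x * p + y * q) * (fst c1 * fst m + snd c1 * snd m)"
      unfolding s(1) by (simp add: D_def e_def b_def algebra_simps)
    then have "fst c1 * fst m + snd c1 * snd m = int (nat \<bar>D\<bar>) * a + e * b"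
      by (simp add: unit)
    moreover have "fst c2 * fst m + snd c2 * snd m = int (nat G) * b" using G
      by (simp add: b_def pq algebra_simps)
    ultimately show "v \<in> Lam" unfolding v by (rule LamI)
  qed
  moreover have "int (nat \<bar>D\<bar> * nat G) = \<bar>det2 c1 c2\<bar>"
    using G by (simp add: DG[symmetric] abs_mult)
  ultimately show ?thesis using that d_pos g_pos by blast
qed

section \<open>Polynomials in finitely many variables over the integers\<close>

lemma poly_mapping_sum_single:
  fixes F :: "'a \<Rightarrow>\<^sub>0 'b::comm_monoid_add"
  shows "F = (\<Sum>m\<in>Poly_Mapping.keys F. Poly_Mapping.single m (Poly_Mapping.lookup F m))"
proof (rule poly_mapping_eqI)
  fix k
  show "Poly_Mapping.lookup F k =
      Poly_Mapping.lookup (\<Sum>m\<in>Poly_Mapping.keys F. Poly_Mapping.single m (Poly_Mapping.lookup F m)) k"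
    by (simp add: lookup_sum lookup_single when_def in_keys_iff)
qed

lemma lookup_mult_sum:
  fixes F G :: "'a::comm_monoid_add \<Rightarrow>\<^sub>0 'b::comm_semiring_1"
  shows "Poly_Mapping.lookup (F * G) k = (\<Sum>m\<in>Poly_Mapping.keys F. \<Sum>n\<in>Poly_Mapping.keys G.
    if m + n = k then Poly_Mapping.lookup F m * Poly_Mapping.lookup G n else 0)"
proof -
  have "F * G = (\<Sum>m\<in>Poly_Mapping.keys F. \<Sum>n\<in>Poly_Mapping.keys G.
      Poly_Mapping.single (m + n) (Poly_Mapping.lookup F m * Poly_Mapping.lookup G n))"
    by (subst poly_mapping_sum_single[of F], subst poly_mapping_sum_single[of G])
      (simp add: sum_product mult_single)
  then show ?thesis by (simp add: lookup_sum lookup_single when_def)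
qed

text \<open>If the exponent a + b arises from only one pair of terms, nothing can cancel. This
  serves both multiplication by a monomial and extremal exponents.\<close>

lemma lookup_mult_unique:
  fixes F G :: "'a::comm_monoid_add \<Rightarrow>\<^sub>0 'b::comm_semiring_1"
  assumes uniq: "\<And>m n. m \<in> Poly_Mapping.keys F \<Longrightarrow> n \<in> Poly_Mapping.keys G \<Longrightarrow>
      m + n = a + b \<Longrightarrow> m = a \<and> n = b"
  shows "Poly_Mapping.lookup (F * G) (a + b) = Poly_Mapping.lookup F a * Poly_Mapping.lookup G b"
proof -
  have "Poly_Mapping.lookup (F * G) (a + b) = (\<Sum>m\<in>Poly_Mapping.keys F. \<Sum>n\<in>Poly_Mapping.keys G.
      if m = a then (if n = b then Poly_Mapping.lookup F a * Poly_Mapping.lookup G b else 0) else 0)"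
    unfolding lookup_mult_sum by (intro sum.cong refl) (use uniq in auto)
  also have "\<dots> = (\<Sum>m\<in>Poly_Mapping.keys F. if m = a then
      (\<Sum>n\<in>Poly_Mapping.keys G. if n = b then Poly_Mapping.lookup F a * Poly_Mapping.lookup G b else 0) else 0)"
    by (intro sum.cong refl) auto
  also have "\<dots> = Poly_Mapping.lookup F a * Poly_Mapping.lookup G b"
    by (auto simp: in_keys_iff)
  finally show ?thesis .
qed

lemma lookup_single_times:
  fixes F :: "'a::cancel_comm_monoid_add \<Rightarrow>\<^sub>0 'b::comm_semiring_1"
  shows "Poly_Mapping.lookup (Poly_Mapping.single a c * F) (a + m) = c * Poly_Mapping.lookup F m"
  by (subst lookup_mult_unique) (auto split: if_splits)

lemma keys_single_times:
  fixes F :: "'a::cancel_comm_monoid_add \<Rightarrow>\<^sub>0 'b::idom"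
  assumes "c \<noteq> 0"
  shows "Poly_Mapping.keys (Poly_Mapping.single a c * F) = (+) a ` Poly_Mapping.keys F"
proof
  show "Poly_Mapping.keys (Poly_Mapping.single a c * F) \<subseteq> (+) a ` Poly_Mapping.keys F"
    using keys_mult[of "Poly_Mapping.single a c" F] assms by auto
  show "(+) a ` Poly_Mapping.keys F \<subseteq> Poly_Mapping.keys (Poly_Mapping.single a c * F)"
    using assms by (auto simp: in_keys_iff lookup_single_times)
qed

lemma num_terms_single_times:
  fixes F :: "'b::idom mpoly"
  assumes "c \<noteq> 0"
  shows "num_terms (Poly_Mapping.single a c * F) = num_terms F"
  unfolding num_terms_def keys_single_times[OF assms] by (rule card_image) simp

text \<open>In the linear order on exponents, which is compatible with addition, the sum of the
  largest exponents of F and G arises in only one way, and so does the sum of the smallest. Both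
  survive in the product 1, which squeezes the exponents of F to 0.\<close>

lemma mpoly_dvd_one_keys:
  fixes F :: "int mpoly"
  assumes "F dvd 1"
  shows "Poly_Mapping.keys F = {0}"
proof -
  from assms obtain G where FG: "F * G = 1" by (metis dvdE)
  then have ne: "Poly_Mapping.keys F \<noteq> {}" "Poly_Mapping.keys G \<noteq> {}" by auto
  have sum0: "a = 0" if a: "a \<in> Poly_Mapping.keys F" and b: "b \<in> Poly_Mapping.keys G"
    and uniq: "\<And>m n. m \<in> Poly_Mapping.keys F \<Longrightarrow> n \<in> Poly_Mapping.keys G \<Longrightarrow>
      m + n = a + b \<Longrightarrow> m = a \<and> n = b" for a b :: "nat \<Rightarrow>\<^sub>0 nat"
  proof -
    have "Poly_Mapping.lookup (F * G) (a + b) = Poly_Mapping.lookup F a * Poly_Mapping.lookup G b"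
      by (rule lookup_mult_unique) (rule uniq)
    then have "Poly_Mapping.lookup (F * G) (a + b) \<noteq> 0"
      using a b by (simp add: in_keys_iff)
    then have "a + b = 0" unfolding FG by (simp add: lookup_one when_def split: if_splits)
    then have "Poly_Mapping.lookup a k + Poly_Mapping.lookup b k = 0" for k
      by (metis lookup_add lookup_zero)
    then show "a = 0" by (intro poly_mapping_eqI) simp
  qed
  have "Max (Poly_Mapping.keys F) = 0"
  proof (rule sum0[where b = "Max (Poly_Mapping.keys G)"])
    fix m n assume "m \<in> Poly_Mapping.keys F" "n \<in> Poly_Mapping.keys G"
      and eq: "m + n = Max (Poly_Mapping.keys F) + Max (Poly_Mapping.keys G)"
    then have "m \<le> Max (Poly_Mapping.keys F)" "n \<le> Max (Poly_Mapping.keys G)" by auto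
    then show "m = Max (Poly_Mapping.keys F) \<and> n = Max (Poly_Mapping.keys G)"
      using eq add_less_le_mono add_le_less_mono by (metis less_irrefl order_le_imp_less_or_eq)
  qed (use ne in auto)
  moreover have "Min (Poly_Mapping.keys F) = 0"
  proof (rule sum0[where b = "Min (Poly_Mapping.keys G)"])
    fix m n assume "m \<in> Poly_Mapping.keys F" "n \<in> Poly_Mapping.keys G"
      and eq: "m + n = Min (Poly_Mapping.keys F) + Min (Poly_Mapping.keys G)"
    then have "Min (Poly_Mapping.keys F) \<le> m" "Min (Poly_Mapping.keys G) \<le> n" by auto
    then show "m = Min (Poly_Mapping.keys F) \<and> n = Min (Poly_Mapping.keys G)"
      using eq add_less_le_mono add_le_less_mono by (metis less_irrefl order_le_imp_less_or_eq)
  qed (use ne in auto)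
  ultimately have "m = 0" if "m \<in> Poly_Mapping.keys F" for m
    using that by (metis Max_ge Min_le finite_keys order_antisym)
  then show ?thesis using ne(1) by blast
qed

abbreviation var :: "nat \<Rightarrow> int mpoly" where
  "var k \<equiv> Poly_Mapping.single (Poly_Mapping.single k 1) 1"

lemma single_minus_var:
  assumes "Poly_Mapping.lookup m k > 0"
  shows "Poly_Mapping.single k 1 + (m - Poly_Mapping.single k 1) = (m :: nat \<Rightarrow>\<^sub>0 nat)"
  using assms by (intro poly_mapping_eqI) (auto simp: lookup_add lookup_minus lookup_single when_def)

lemma var_dvd_iff: "var k dvd F \<longleftrightarrow> (\<forall>m\<in>Poly_Mapping.keys F. Poly_Mapping.lookup m k > 0)"
proof
  assume "var k dvd F"
  then obtain G where "F = var k * G" by (elim dvdE)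
  then show "\<forall>m\<in>Poly_Mapping.keys F. Poly_Mapping.lookup m k > 0"
    by (auto simp: keys_single_times lookup_add)
next
  assume pos: "\<forall>m\<in>Poly_Mapping.keys F. Poly_Mapping.lookup m k > 0"
  have "var k dvd (\<Sum>m\<in>Poly_Mapping.keys F. Poly_Mapping.single m (Poly_Mapping.lookup F m))"
  proof (rule dvd_sum)
    fix m assume "m \<in> Poly_Mapping.keys F"
    then have "Poly_Mapping.single m (Poly_Mapping.lookup F m) =
        var k * Poly_Mapping.single (m - Poly_Mapping.single k 1) (Poly_Mapping.lookup F m)"
      using pos single_minus_var by (simp add: mult_single)
    then show "var k dvd Poly_Mapping.single m (Poly_Mapping.lookup F m)" by (rule dvdI)
  qed
  then show "var k dvd F" using poly_mapping_sum_single[of F] by simp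
qed

text \<open>The argument sets X_k to 0: \<open>part\<close> keeps the terms free of X_k. If X_k
  divides F G, the product of the two parts is both divisible by X_k and free of it, hence 0, and
  the ring is a domain.\<close>

lemma var_dvd_mult:
  assumes "var k dvd F * G" shows "var k dvd F \<or> var k dvd G"
proof -
  define part where "part = (\<lambda>H :: int mpoly. \<Sum>m\<in>{m \<in> Poly_Mapping.keys H. Poly_Mapping.lookup m k = 0}.
      Poly_Mapping.single m (Poly_Mapping.lookup H m))"
  have lk: "Poly_Mapping.lookup (part H) m =
      (if Poly_Mapping.lookup m k = 0 then Poly_Mapping.lookup H m else 0)" for H m
    by (auto simp: part_def lookup_sum lookup_single when_def in_keys_iff)
  have rest: "var k dvd H - part H" for H
    unfolding var_dvd_iff by (auto simp: in_keys_iff lookup_minus lk split: if_splits)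
  have "F * G = part F * part G + ((F - part F) * G + part F * (G - part G))"
    by (simp add: algebra_simps)
  moreover have "var k dvd (F - part F) * G + part F * (G - part G)"
    by (intro dvd_add dvd_mult dvd_mult2 rest)
  ultimately have "var k dvd part F * part G"
    using assms by (metis dvd_add_left_iff)
  moreover have "Poly_Mapping.lookup m k = 0" if "m \<in> Poly_Mapping.keys (part F * part G)" for m
  proof -
    obtain a b where "m = a + b" "a \<in> Poly_Mapping.keys (part F)" "b \<in> Poly_Mapping.keys (part G)"
      using \<open>m \<in> Poly_Mapping.keys (part F * part G)\<close> keys_mult by blast
    then show ?thesis by (auto simp: in_keys_iff lk lookup_add split: if_splits)
  qed
  ultimately have "Poly_Mapping.keys (part F * part G) = {}"
    unfolding var_dvd_iff by fastforce
  then have "part F * part G = 0" by (simp only: keys_eq_empty)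
  then have "part F = 0 \<or> part G = 0" by (simp only: mult_eq_0_iff)
  then show ?thesis using rest[of F] rest[of G] by (metis diff_zero)
qed

lemma exponent_induct:
  fixes m :: "nat \<Rightarrow>\<^sub>0 nat"
  assumes zero: "P 0" and step: "\<And>m k. P m \<Longrightarrow> P (Poly_Mapping.single k 1 + m)"
  shows "P m"
proof (induction m rule: measure_induct_rule[where f = "\<lambda>m. \<Sum>k\<in>Poly_Mapping.keys m. Poly_Mapping.lookup m k"])
  case (less m)
  show ?case
  proof (cases "m = 0")
    case True
    then show ?thesis using zero by simp
  next
    case False
    then obtain k where k: "k \<in> Poly_Mapping.keys m" by fastforce
    define m' where "m' = m - Poly_Mapping.single k 1"
    have lm': "Poly_Mapping.lookup m' i = Poly_Mapping.lookup m i - (if i = k then 1 else 0)" for i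
      by (simp add: m'_def lookup_minus lookup_single when_def)
    have "(\<Sum>i\<in>Poly_Mapping.keys m'. Poly_Mapping.lookup m' i) = (\<Sum>i\<in>Poly_Mapping.keys m. Poly_Mapping.lookup m' i)"
      by (rule sum.mono_neutral_left) (auto simp: in_keys_iff lm' split: if_splits)
    also have "\<dots> < (\<Sum>i\<in>Poly_Mapping.keys m. Poly_Mapping.lookup m i)"
      using k by (intro sum_strict_mono_ex1) (auto simp: lm' in_keys_iff intro!: bexI[of _ k])
    finally have "P m'" by (rule less)
    moreover have "m = Poly_Mapping.single k 1 + m'"
      using k single_minus_var[of m k] by (simp add: m'_def in_keys_iff)
    ultimately show ?thesis using step by metis
  qed
qed

text \<open>Variables are prime, so the monomial can be cancelled one variable at a time, from \<open>D\<close> or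
  from \<open>G\<close>, without changing the number of terms of \<open>D\<close>.\<close>

lemma num_terms_irreducible_eq:
  fixes P D G :: "int mpoly"
  assumes "irreducible P" "Poly_Mapping.single m 1 * P = D * G" "num_terms D \<ge> 2"
  shows "num_terms P = num_terms D"
  using assms(2,3)
proof (induction m arbitrary: D G rule: exponent_induct)
  case 1
  then have P: "P = D * G" by simp
  then consider "D dvd 1" | "G dvd 1" using assms(1) irreducibleD by blast
  then show ?case
  proof cases
    case 1
    \<comment> \<open>A unit has a single term, so the two terms of \<open>D\<close> rule this case
      out.\<close>
    then have "num_terms D = 1" by (simp add: num_terms_def mpoly_dvd_one_keys)
    then show ?thesis using \<open>num_terms D \<ge> 2\<close> by simp
  next
    case 2
    then have k: "Poly_Mapping.keys G = {0}" by (rule mpoly_dvd_one_keys)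
    define c where "c = Poly_Mapping.lookup G 0"
    have "G = Poly_Mapping.single 0 c"
      using poly_mapping_sum_single[of G] unfolding k c_def by simp
    moreover have "c \<noteq> 0" using k by (auto simp: c_def in_keys_iff)
    ultimately show ?thesis using P num_terms_single_times[of c 0 D] by (simp add: mult.commute)
  qed
next
  case (2 m k)
  note IH = 2(1) and terms = 2(3)
  have eq: "var k * (Poly_Mapping.single m 1 * P) = D * G"
    using 2(2) by (simp add: mult_single mult.assoc[symmetric])
  then have "var k dvd D * G" by (metis dvdI)
  then consider D' where "D = var k * D'" | G' where "G = var k * G'"
    using var_dvd_mult by (meson dvdE)
  then show ?case
  proof cases
    case 1
    have "var k * (Poly_Mapping.single m 1 * P) = var k * (D' * G)"
      using eq unfolding 1 by (simp only: mult.assoc)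
    then have "Poly_Mapping.single m 1 * P = D' * G" by (simp add: mult_cancel_left)
    moreover have "num_terms D' = num_terms D" unfolding 1 by (simp add: num_terms_single_times)
    ultimately show ?thesis using IH[of D' G] terms by simp
  next
    case 2
    have "var k * (Poly_Mapping.single m 1 * P) = var k * (D * G')"
      using eq unfolding 2 by (simp only: mult.left_commute)
    then have "Poly_Mapping.single m 1 * P = D * G'" by (simp add: mult_cancel_left)
    then show ?thesis using IH terms by blast
  qed
qed

section \<open>The norm of a line\<close>

text \<open>The outer variable is y and the inner one x: \<open>coeff (coeff F j) i\<close> belongs
  to x^i y^j.\<close>

definition eval2 :: "int poly poly \<Rightarrow> complex \<Rightarrow> complex \<Rightarrow> complex" where
  "eval2 F x y = poly (map_poly (\<lambda>a. poly (of_int_poly a) x) F) y"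

lemma comm_ring_hom_eval: "comm_ring_hom (\<lambda>a. poly (of_int_poly a) (x::complex))"
  by unfold_locales (auto simp: hom_distribs)

lemma eval2_add: "eval2 (F + G) x y = eval2 F x y + eval2 G x y"
proof -
  interpret comm_ring_hom "\<lambda>a. poly (of_int_poly a) x" by (rule comm_ring_hom_eval)
  interpret m: map_poly_comm_ring_hom "\<lambda>a. poly (of_int_poly a) x" ..
  show ?thesis by (simp add: eval2_def m.hom_add)
qed

lemma eval2_mult: "eval2 (F * G) x y = eval2 F x y * eval2 G x y"
proof -
  interpret comm_ring_hom "\<lambda>a. poly (of_int_poly a) x" by (rule comm_ring_hom_eval)
  interpret m: map_poly_comm_ring_hom "\<lambda>a. poly (of_int_poly a) x" ..
  show ?thesis by (simp add: eval2_def m.hom_mult)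
qed

lemma eval2_poly: "eval2 F x (poly (of_int_poly a) x) = poly (of_int_poly (poly F a)) x"
proof -
  interpret comm_ring_hom "\<lambda>a. poly (of_int_poly a) x" by (rule comm_ring_hom_eval)
  show ?thesis unfolding eval2_def by (rule poly_map_poly)
qed

text \<open>Substituting \<open>[:-1, -1:]\<close>, that is -1 - x, for y expresses vanishing on x +
  y + 1 = 0 purely over the integers.\<close>

lemma eval2_line:
  assumes "poly F [:-1, -1:] = 0"
  shows "eval2 F x (-1 - x) = 0"
  using eval2_poly[of F x "[:-1, -1:]"] assms by (simp add: map_poly_pCons hom_distribs)

lemma eval2_expand:
  "eval2 F x y = (\<Sum>j\<le>degree F. \<Sum>i\<le>degree (coeff F j). of_int (coeff (coeff F j) i) * x ^ i * y ^ j)"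
proof -
  interpret comm_ring_hom "\<lambda>a. poly (of_int_poly a) x" by (rule comm_ring_hom_eval)
  have "eval2 F x y = (\<Sum>j\<le>degree F. poly (of_int_poly (coeff F j)) x * y ^ j)"
  proof -
    have "eval2 F x y = (\<Sum>j\<le>degree (map_poly (\<lambda>a. poly (of_int_poly a) x) F).
        poly (of_int_poly (coeff F j)) x * y ^ j)"
      unfolding eval2_def poly_altdef by (simp add: coeff_map_poly)
    also have "\<dots> = (\<Sum>j\<le>degree F. poly (of_int_poly (coeff F j)) x * y ^ j)"
    proof (rule sum.mono_neutral_left)
      show "\<forall>j\<in>{..degree F} - {..degree (map_poly (\<lambda>a. poly (of_int_poly a) x) F)}.
          poly (of_int_poly (coeff F j)) x * y ^ j = 0"
      proof
        fix j assume "j \<in> {..degree F} - {..degree (map_poly (\<lambda>a. poly (of_int_poly a) x) F)}"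
        then have "coeff (map_poly (\<lambda>a. poly (of_int_poly a) x) F) j = 0" by (intro coeff_eq_0) simp
        then show "poly (of_int_poly (coeff F j)) x * y ^ j = 0" by (simp add: coeff_map_poly)
      qed
    qed (simp_all add: degree_map_poly_le)
    finally show ?thesis .
  qed
  also have "\<dots> = (\<Sum>j\<le>degree F. \<Sum>i\<le>degree (coeff F j). of_int (coeff (coeff F j) i) * x ^ i * y ^ j)"
    by (intro sum.cong refl) (simp add: poly_altdef sum_distrib_right)
  finally show ?thesis .
qed

section \<open>The group determinant and the divisibility by it\<close>

context hermite_lattice
begin

definition coset_supp :: "int \<times> int \<Rightarrow> int poly poly \<Rightarrow> bool" where
  "coset_supp c F \<longleftrightarrow> (\<forall>i j. coeff (coeff F j) i \<noteq> 0 \<longrightarrow> (int i, int j) - c \<in> Lam)"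

text \<open>Degree bound and coset are recorded together: both add under products, so they can be
  followed through the Leibniz expansion of a determinant.\<close>

definition graded :: "nat \<Rightarrow> int \<times> int \<Rightarrow> int poly poly \<Rightarrow> bool" where
  "graded n c F \<longleftrightarrow> (\<forall>i j. coeff (coeff F j) i \<noteq> 0 \<longrightarrow> i + j \<le> n \<and> (int i, int j) - c \<in> Lam)"

lemma graded_add:
  assumes "graded n c F" "graded n c G" shows "graded n c (F + G)"
  unfolding graded_def
proof (intro allI impI)
  fix i j assume "coeff (coeff (F + G) j) i \<noteq> 0"
  then have "coeff (coeff F j) i \<noteq> 0 \<or> coeff (coeff G j) i \<noteq> 0" by auto
  then show "i + j \<le> n \<and> (int i, int j) - c \<in> Lam"
    using assms unfolding graded_def by blast
qed

lemma graded_zero: "graded n c 0"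
  by (simp add: graded_def)

lemma graded_uminus: "graded n c F \<Longrightarrow> graded n c (- F)"
  unfolding graded_def by simp

lemma graded_sum: "(\<And>i. i \<in> I \<Longrightarrow> graded n c (f i)) \<Longrightarrow> graded n c (\<Sum>i\<in>I. f i)"
  by (induction I rule: infinite_finite_induct) (simp_all add: graded_add graded_zero)

lemma graded_mult:
  assumes "graded n c F" "graded m c' G" shows "graded (n + m) (c + c') (F * G)"
  unfolding graded_def
proof (intro allI impI)
  fix i j assume "coeff (coeff (F * G) j) i \<noteq> 0"
  then have "(\<Sum>j'\<le>j. \<Sum>i'\<le>i. coeff (coeff F j') i' * coeff (coeff G (j - j')) (i - i')) \<noteq> 0"
    by (simp add: coeff_mult coeff_sum)
  then obtain j' i' where le: "j' \<le> j" "i' \<le> i"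
    and nz: "coeff (coeff F j') i' \<noteq> 0" "coeff (coeff G (j - j')) (i - i') \<noteq> 0"
    by (metis (no_types, lifting) atMost_iff mult_eq_0_iff sum.neutral)
  from nz assms have "i' + j' \<le> n" "(i - i') + (j - j') \<le> m"
    and L: "((int i', int j') - c) + ((int (i - i'), int (j - j')) - c') \<in> Lam"
    by (auto simp: graded_def intro!: Lam_add)
  moreover have "((int i', int j') - c) + ((int (i - i'), int (j - j')) - c') = (int i, int j) - (c + c')"
    using le by (simp add: prod_eq_iff of_nat_diff)
  ultimately show "i + j \<le> n + m \<and> (int i, int j) - (c + c') \<in> Lam"
    using le by (intro conjI) (linarith, simp only:)
qed

lemma graded_prod:
  assumes "finite I" "\<And>k. k \<in> I \<Longrightarrow> graded 1 (c k) (f k)"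
  shows "graded (card I) (\<Sum>k\<in>I. c k) (\<Prod>k\<in>I. f k)"
  using assms
proof (induction I)
  case empty
  then show ?case using Lam_zero by (auto simp: graded_def zero_prod_def coeff_pCons split: nat.splits)
next
  case (insert k I)
  then have "graded (1 + card I) (c k + (\<Sum>k\<in>I. c k)) (f k * (\<Prod>k\<in>I. f k))"
    by (intro graded_mult) auto
  then show ?case using insert by simp
qed

lemma graded_coset:
  assumes "graded n c F" "c - c' \<in> Lam" shows "graded n c' F"
proof -
  have "v - c' \<in> Lam" if "v - c \<in> Lam" for v
    using Lam_add[OF that assms(2)] by simp
  then show ?thesis using assms(1) by (simp add: graded_def)
qed

text \<open>The matrix of multiplication by \<open>-(p q\<^sup>-\<^sup>1 + q\<^sup>-\<^sup>1)\<close> (up to the identification of each coset of the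
  lattice with its representative); its characteristic polynomial in \<open>q\<close> is the group determinant of
  \<open>q + p + 1\<close>.\<close>

definition step_mat :: "int poly mat" where
  "step_mat = mat idx idx (\<lambda>(k, l).
     - ((if rep k + (1, -1) - rep l \<in> Lam then [:0, 1:] else 0) +
        (if rep k + (0, -1) - rep l \<in> Lam then 1 else 0)))"

definition norm_poly :: "int poly poly" where
  "norm_poly = char_poly step_mat"

lemma step_mat_carrier: "step_mat \<in> carrier_mat idx idx"
  by (simp add: step_mat_def)

lemma norm_poly_monic: "degree norm_poly = idx" "lead_coeff norm_poly = 1"
  using degree_monic_char_poly[OF step_mat_carrier] by (simp_all add: norm_poly_def)

lemma char_poly_matrix_entry:
  assumes "k < idx" "l < idx"
  shows "char_poly_matrix step_mat $$ (k, l) = (if k = l then [:0, 1:] else 0) +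
    [: (if rep k + (1, -1) - rep l \<in> Lam then [:0, 1:] else 0) +
       (if rep k + (0, -1) - rep l \<in> Lam then 1 else 0) :]"
  using assms by (simp add: char_poly_matrix_def step_mat_def)

lemma graded_monomial:
  assumes "i + j \<le> n" "(int i, int j) - c \<in> Lam"
  shows "graded n c (monom (monom 1 i) j)"
  using assms by (auto simp: graded_def coeff_monom split: if_splits)

text \<open>The summands y, x and 1 of an entry occur only where their exponents are congruent to
  rep l - rep k + (0, 1) modulo \<open>Lam\<close>.\<close>

lemma graded_entry:
  assumes "k < idx" "l < idx"
  shows "graded 1 (rep l - rep k + (0, 1)) (char_poly_matrix step_mat $$ (k, l))"
proof -
  let ?c = "rep l - rep k + (0, 1)"
  have "graded 1 ?c (if k = l then monom (monom 1 0) 1 else 0)"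
  proof (cases "k = l")
    case True
    then have "(int 0, int 1) - ?c = 0" by (simp add: prod_eq_iff)
    then show ?thesis using graded_monomial[of 0 1 1 ?c] Lam_zero True by simp
  qed (simp add: graded_def)
  moreover have "graded 1 ?c (if rep k + (1, -1) - rep l \<in> Lam then monom (monom 1 1) 0 else 0)"
  proof -
    have "(int 1, int 0) - ?c = rep k + (1, -1) - rep l" by (simp add: prod_eq_iff)
    then show ?thesis using graded_monomial[of 1 0 1 ?c] graded_zero by (simp only: split: if_splits) simp
  qed
  moreover have "graded 1 ?c (if rep k + (0, -1) - rep l \<in> Lam then monom (monom 1 0) 0 else 0)"
  proof -
    have "(int 0, int 0) - ?c = rep k + (0, -1) - rep l" by (simp add: prod_eq_iff)
    then show ?thesis using graded_monomial[of 0 0 1 ?c] graded_zero by (simp only: split: if_splits) simp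
  qed
  moreover have "char_poly_matrix step_mat $$ (k, l) =
      (if k = l then monom (monom 1 0) 1 else 0) +
      (if rep k + (1, -1) - rep l \<in> Lam then monom (monom 1 1) 0 else 0) +
      (if rep k + (0, -1) - rep l \<in> Lam then monom (monom 1 0) 0 else 0)"
    unfolding char_poly_matrix_entry[OF assms] by (simp add: monom_0 monom_Suc one_pCons)
  ultimately show ?thesis using graded_add by metis
qed

text \<open>In each Leibniz term the representatives cancel because a permutation only reorders
  them. What remains is \<open>idx\<close> copies of (0, 1), whose sum lies in
  \<open>Lam\<close>.\<close>

lemma norm_poly_graded: "graded idx 0 norm_poly"
proof -
  let ?M = "char_poly_matrix step_mat"
  have M: "?M \<in> carrier_mat idx idx" using step_mat_carrier by simp
  show ?thesis unfolding norm_poly_def char_poly_def det_def'[OF M]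
  proof (rule graded_sum)
    fix \<pi> assume "\<pi> \<in> {\<pi>. \<pi> permutes {0..<idx}}"
    then have \<pi>: "\<pi> permutes {0..<idx}" by simp
    have "graded (card {0..<idx}) (\<Sum>k\<in>{0..<idx}. rep (\<pi> k) - rep k + (0, 1)) (\<Prod>k\<in>{0..<idx}. ?M $$ (k, \<pi> k))"
    proof (rule graded_prod)
      fix k assume k: "k \<in> {0..<idx}"
      then have "\<pi> k \<in> {0..<idx}" using permutes_in_image[OF \<pi>] by blast
      then show "graded 1 (rep (\<pi> k) - rep k + (0, 1)) (?M $$ (k, \<pi> k))"
        using k by (intro graded_entry) simp_all
    qed simp
    moreover have "(\<Sum>k\<in>{0..<idx}. rep (\<pi> k) - rep k + (0, 1)) = (0, int idx)"
    proof -
      have "(\<Sum>k\<in>{0..<idx}. rep (\<pi> k)) = (\<Sum>k\<in>{0..<idx}. rep k)"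
        using sum.permute[OF \<pi>, of rep] by (simp add: o_def)
      moreover have "(\<Sum>k\<in>{0..<idx}. (0, 1)) = (0, int idx)"
        by (simp add: prod_eq_iff fst_sum snd_sum)
      ultimately show ?thesis by (simp add: sum.distrib sum_subtractf)
    qed
    ultimately have "graded idx (0, int idx) (\<Prod>k\<in>{0..<idx}. ?M $$ (k, \<pi> k))" by simp
    then have g: "graded idx 0 (\<Prod>k\<in>{0..<idx}. ?M $$ (k, \<pi> k))"
      by (rule graded_coset) (simp add: Lam_idx_snd)
    show "graded idx 0 (signof \<pi> * (\<Prod>k = 0..<idx. ?M $$ (k, \<pi> k)))"
    proof (cases "sign \<pi> = 1")
      case True
      then show ?thesis using g by simp
    next
      case False
      then have "sign \<pi> = -1" by (simp add: sign_def split: if_splits)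
      then show ?thesis using graded_uminus[OF g] by simp
    qed
  qed
qed

lemma sum_rep: "(\<Sum>l\<in>{0..<idx}. if v - rep l \<in> Lam then x else 0) = x"
proof -
  obtain k where k: "k < idx" "v - rep k \<in> Lam" "\<And>l. l < idx \<Longrightarrow> v - rep l \<in> Lam \<Longrightarrow> l = k"
    using rep_ex1[of v] by blast
  have "(\<Sum>l\<in>{0..<idx}. if v - rep l \<in> Lam then x else 0) = (\<Sum>l\<in>{0..<idx}. if l = k then x else 0)"
  proof (rule sum.cong[OF refl])
    fix l assume "l \<in> {0..<idx}"
    then have "v - rep l \<in> Lam \<longleftrightarrow> l = k" using k(2) k(3)[of l] by auto
    then show "(if v - rep l \<in> Lam then x else 0) = (if l = k then x else 0)" by simp
  qed
  then show ?thesis using k(1) by simp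
qed

text \<open>On the line every row sum is y + x + 1 = 0, so the all-ones vector, the trivial
  character, is in the kernel of the specialized matrix.\<close>

lemma norm_poly_line: "poly norm_poly [:-1, -1:] = 0"
proof -
  let ?x = "[:-1, -1:] :: int poly"
  let ?M = "map_mat (\<lambda>f. poly f ?x) (char_poly_matrix step_mat)"
  have M0: "char_poly_matrix step_mat \<in> carrier_mat idx idx" using step_mat_carrier by simp
  then have M: "?M \<in> carrier_mat idx idx" by simp
  have hom: "comm_ring_hom (\<lambda>f. poly f ?x)" by unfold_locales auto
  have "poly norm_poly ?x = det ?M"
    unfolding norm_poly_def char_poly_def by (rule comm_ring_hom.hom_det[OF hom, symmetric])
  moreover have "?M *\<^sub>v vec idx (\<lambda>_. 1) = 0\<^sub>v idx"
  proof (rule eq_vecI)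
    fix k assume "k < dim_vec (0\<^sub>v idx :: int poly vec)"
    then have k: "k < idx" by simp
    have "(?M *\<^sub>v vec idx (\<lambda>_. 1)) $ k = (\<Sum>l\<in>{0..<idx}. ?M $$ (k, l))"
      using k M0 by (simp add: scalar_prod_def)
    also have "\<dots> = (\<Sum>l\<in>{0..<idx}. (if k = l then ?x else 0) +
        ((if rep k + (1, -1) - rep l \<in> Lam then [:0, 1:] else 0) +
         (if rep k + (0, -1) - rep l \<in> Lam then 1 else 0)))"
      using k M0 by (intro sum.cong refl) (simp add: char_poly_matrix_entry)
    also have "\<dots> = 0" using k by (simp add: sum.distrib sum_rep one_pCons)
    finally show "(?M *\<^sub>v vec idx (\<lambda>_. 1)) $ k = 0\<^sub>v idx $ k" using k by simp
  qed (use M in simp)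
  moreover have "vec idx (\<lambda>_. 1) \<noteq> (0\<^sub>v idx :: int poly vec)"
    using idx_pos by (metis index_vec index_zero_vec(1) zero_neq_one)
  ultimately show ?thesis using det_0_iff_vec_prod_zero[OF M] by (metis vec_carrier)
qed

text \<open>The characters of \<open>\<int>\<^sup>2\<close> that are trivial on \<open>Lam\<close>.\<close>

definition chars :: "(complex \<times> complex) set" where
  "chars = Sigma {z. z ^ d = 1} (\<lambda>z. {w. w ^ g = z powi (- e)})"

lemma chars_nz: "(z, w) \<in> chars \<Longrightarrow> z \<noteq> 0 \<and> w \<noteq> 0"
  using d_pos g_pos by (auto simp: chars_def zero_power power_0_left power_int_eq_0_iff)

text \<open>A pair (z, w) gives the values of a character at (1, 0) and (0, 1). Triviality on (d, 0)
  leaves d roots of unity z, and triviality on (e, g) then leaves g roots w for each.\<close>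

lemma card_chars: "card chars = idx"
proof -
  have fin: "finite {z::complex. z ^ n = c}" "card {z::complex. z ^ n = c} = n" if "n > 0" "c \<noteq> 0" for n c
    using that card_nth_roots[of c n] by (auto intro: card_ge_0_finite)
  have "card chars = (\<Sum>z\<in>{z::complex. z ^ d = 1}. card {w::complex. w ^ g = z powi (- e)})"
    unfolding chars_def
  proof (rule card_SigmaI)
    show "\<forall>z\<in>{z::complex. z ^ d = 1}. finite {w. w ^ g = z powi (- e)}"
    proof
      fix z :: complex assume "z \<in> {z. z ^ d = 1}"
      then have "z powi (- e) \<noteq> 0" using d_pos by (auto simp: power_int_eq_0_iff power_0_left)
      then show "finite {w. w ^ g = z powi (- e)}" by (rule fin(1)[OF g_pos])
    qed
  qed (use fin(1)[of d 1] d_pos in simp)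
  also have "\<dots> = (\<Sum>z\<in>{z::complex. z ^ d = 1}. g)"
    using d_pos g_pos by (intro sum.cong refl fin) (auto simp: power_int_eq_0_iff power_0_left)
  also have "\<dots> = idx" using fin(2)[of d 1] d_pos by (simp add: idx_def)
  finally show ?thesis .
qed

lemma finite_chars: "finite chars"
  by (rule card_ge_0_finite) (simp add: card_chars idx_pos)

lemma char_Lam:
  assumes "(z, w) \<in> chars" "(i, j) \<in> Lam" shows "z powi i * w powi j = 1"
proof -
  obtain a b where ab: "i = int d * a + e * b" "j = int g * b" using assms(2) by (auto elim: LamE)
  have nz: "z \<noteq> 0" "w \<noteq> 0" using chars_nz assms(1) by auto
  have zw: "z powi int d = 1" "w powi int g = z powi (- e)"
    using assms(1) by (auto simp: chars_def)
  have "z powi i * w powi j = (z powi int d) powi a * (z powi e) powi b * (w powi int g) powi b"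
    using nz by (simp only: ab power_int_add power_int_mult simp_thms)
  also have "\<dots> = (z powi e * w powi int g) powi b" using zw by (simp add: power_int_mult_distrib)
  also have "z powi e * w powi int g = 1" using nz zw(2) by (simp only: power_int_minus) simp
  finally show ?thesis by simp
qed

text \<open>Every exponent in the coset of c gets the same character value, so F is an eigenvector
  of the action.\<close>

lemma eval2_twist:
  assumes zw: "(z, w) \<in> chars" and F: "coset_supp c F"
  shows "eval2 F (z * x) (w * y) = z powi fst c * w powi snd c * eval2 F x y"
proof -
  have nz: "z \<noteq> 0" "w \<noteq> 0" using chars_nz zw by auto
  have tw: "z ^ i * w ^ j = z powi fst c * w powi snd c" if "coeff (coeff F j) i \<noteq> 0" for i j
  proof -
    have "(int i - fst c, int j - snd c) \<in> Lam"
      using F that unfolding coset_supp_def by (metis minus_prod_def fst_conv snd_conv)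
    from char_Lam[OF zw this] have "z powi int i * w powi int j = z powi fst c * w powi snd c"
      using nz by (simp add: power_int_diff field_simps)
    then show ?thesis by simp
  qed
  have "of_int (coeff (coeff F j) i) * (z * x) ^ i * (w * y) ^ j =
      z powi fst c * w powi snd c * (of_int (coeff (coeff F j) i) * x ^ i * y ^ j)" for i j
  proof (cases "coeff (coeff F j) i = 0")
    case False
    have "of_int (coeff (coeff F j) i) * (z * x) ^ i * (w * y) ^ j =
      (z ^ i * w ^ j) * (of_int (coeff (coeff F j) i) * x ^ i * y ^ j)"
      by (simp add: power_mult_distrib)
    then show ?thesis using tw[OF False] by simp
  qed simp
  then show ?thesis unfolding eval2_expand sum_distrib_left by (intro sum.cong refl)
qed

text \<open>The twist maps the point (x / z, -1 - x / z) of the original line to (x, w (-1 - x /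
  z)).\<close>

lemma eval2_twisted_line:
  assumes zw: "(z, w) \<in> chars" and F: "coset_supp c F" and line: "poly F [:-1, -1:] = 0"
  shows "eval2 F x (w * (-1 - x / z)) = 0"
proof -
  have "eval2 F (z * (x / z)) (w * (-1 - x / z)) = 0"
    unfolding eval2_twist[OF zw F] eval2_line[OF line] by (rule mult_zero_right)
  then show ?thesis using chars_nz[OF zw] by simp
qed

text \<open>A twisted line has slope -w / z and intercept -w, which determine the character. Two
  distinct lines meet over at most one x.\<close>

lemma twisted_lines_distinct:
  "finite {x. \<not> inj_on (\<lambda>(z, w). w * (-1 - x / z)) chars}"
proof (rule finite_subset)
  let ?B = "insert 0 ((\<lambda>((z, w), (z', w')). (w' - w) / (w / z - w' / z')) ` (chars \<times> chars))"
  show "finite ?B" using finite_chars by simp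
  show "{x. \<not> inj_on (\<lambda>(z, w). w * (-1 - x / z)) chars} \<subseteq> ?B"
  proof
    fix x assume "x \<in> {x. \<not> inj_on (\<lambda>(z, w). w * (-1 - x / z)) chars}"
    then obtain z w z' w' where ch: "(z, w) \<in> chars" "(z', w') \<in> chars" and ne: "(z, w) \<noteq> (z', w')"
      and eq: "w * (-1 - x / z) = w' * (-1 - x / z')"
      by (auto simp: inj_on_def)
    have nz: "z \<noteq> 0" "w \<noteq> 0" "z' \<noteq> 0" "w' \<noteq> 0" using chars_nz ch by auto
    have eq': "x * (w / z - w' / z') = w' - w" using eq by (simp add: algebra_simps)
    show "x \<in> ?B"
    proof (cases "w / z - w' / z' = 0")
      case True
      then have "w = w'" using eq' by simp
      then show ?thesis using True ne nz by (simp add: field_simps)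
    next
      case False
      then have "x = (w' - w) / (w / z - w' / z')" using eq' by (simp add: field_simps)
      then show ?thesis using ch by (intro insertI2 image_eqI[where x = "((z, w), (z', w'))"]) auto
    qed
  qed
qed

text \<open>After division in y, the remainder R vanishes on all twisted lines because F and the
  norm do. For all but finitely many x these supply \<open>idx\<close> distinct roots in y, more
  than the degree of R allows.\<close>

lemma norm_poly_dvd:
  assumes F: "coset_supp c F" and line: "poly F [:-1, -1:] = 0"
  shows "norm_poly dvd F"
proof -
  have H0: "norm_poly \<noteq> 0" using norm_poly_monic(2) by auto
  \<comment> \<open>The norm is monic, so pseudo-division involves no multiplier.\<close>
  obtain Q R where QR: "pseudo_divmod F norm_poly = (Q, R)" by fastforce
  have FQR: "F = norm_poly * Q + R" and R: "R = 0 \<or> degree R < idx"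
    using pseudo_divmod[OF H0 QR] norm_poly_monic by auto
  have "R = 0"
  proof (rule ccontr)
    assume "R \<noteq> 0"
    with R have deg: "degree R < idx" by simp
    have H: "coset_supp 0 norm_poly"
      using norm_poly_graded by (auto simp: graded_def coset_supp_def)
    have zeros: "eval2 R x (w * (-1 - x / z)) = 0" if "(z, w) \<in> chars" for x z w
      using eval2_twisted_line[OF that F line, of x] eval2_twisted_line[OF that H norm_poly_line, of x]
      unfolding FQR eval2_add eval2_mult by simp
    have vanish: "poly (of_int_poly (coeff R j)) x = 0"
      if inj: "inj_on (\<lambda>(z, w). w * (-1 - x / z)) chars" for x :: complex and j
    proof -
      interpret comm_ring_hom "\<lambda>a. poly (of_int_poly a) x" by (rule comm_ring_hom_eval)
      let ?R = "map_poly (\<lambda>a. poly (of_int_poly a) x) R"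
      have "?R = 0"
      proof (rule ccontr)
        assume nz: "?R \<noteq> 0"
        have "(\<lambda>(z, w). w * (-1 - x / z)) ` chars \<subseteq> {y. poly ?R y = 0}"
          using zeros by (auto simp: eval2_def)
        then have "card ((\<lambda>(z, w). w * (-1 - x / z)) ` chars) \<le> card {y. poly ?R y = 0}"
          using poly_roots_finite[OF nz] card_mono by blast
        also have "\<dots> \<le> degree ?R" by (rule card_poly_roots_bound[OF nz])
        also have "\<dots> \<le> degree R" by (rule degree_map_poly_le)
        finally show False using card_image[OF inj] card_chars deg by simp
      qed
      then show ?thesis by (metis coeff_0 coeff_map_poly hom_zero)
    qed
    have "coeff R j = 0" for j
    proof -
      have "UNIV - {x. \<not> inj_on (\<lambda>(z, w). w * (-1 - x / z)) chars} \<subseteq>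
          {x :: complex. poly (of_int_poly (coeff R j)) x = 0}"
        using vanish by auto
      then have "infinite {x :: complex. poly (of_int_poly (coeff R j)) x = 0}"
        using twisted_lines_distinct infinite_UNIV_char_0 Diff_infinite_finite infinite_super by metis
      then have "of_int_poly (coeff R j) = (0 :: complex poly)" using poly_roots_finite by blast
      then show ?thesis by simp
    qed
    then have "R = 0" by (intro poly_eqI) simp
    with \<open>R \<noteq> 0\<close> show False ..
  qed
  then show ?thesis using FQR by simp
qed

end

section \<open>Laurent monomials and bivariate polynomials\<close>

text \<open>Multiplying by z^K turns the Laurent polynomial into a polynomial with infinitely many
  zeros, whose coefficients vanish.\<close>

lemma laurent_coeff_zero:
  fixes a :: "'m \<Rightarrow> complex"
  assumes fin: "finite S" and zero: "\<And>z. z \<noteq> 0 \<Longrightarrow> (\<Sum>m\<in>S. a m * z powi e m) = 0"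
  shows "(\<Sum>m\<in>{m \<in> S. e m = c}. a m) = 0"
proof -
  \<comment> \<open>The summand for \<open>c\<close> keeps c + K nonnegative even if no term has
    exponent \<open>c\<close>.\<close>
  define K where "K = (\<Sum>m\<in>S. \<bar>e m\<bar>) + \<bar>c\<bar>"
  have K: "0 \<le> e m + K" if "m \<in> S" for m
    using member_le_sum[OF that, of "\<lambda>m. \<bar>e m\<bar>"] fin by (simp add: K_def)
  have "0 \<le> (\<Sum>m\<in>S. \<bar>e m\<bar>)" by (rule sum_nonneg) simp
  then have Kc: "0 \<le> c + K" unfolding K_def by linarith
  define Q where "Q = (\<Sum>m\<in>S. monom (a m) (nat (e m + K)))"
  have "poly Q z = 0" if z: "z \<noteq> 0" for z
  proof -
    have "poly Q z = (\<Sum>m\<in>S. a m * z powi (e m + K))"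
      unfolding Q_def by (auto simp: poly_sum poly_monom power_int_def K intro!: sum.cong)
    also have "\<dots> = z powi K * (\<Sum>m\<in>S. a m * z powi e m)"
      using z by (simp add: power_int_add sum_distrib_left mult_ac)
    finally show ?thesis using zero[OF z] by simp
  qed
  then have "UNIV - {0} \<subseteq> {z. poly Q z = 0}" by auto
  moreover have "infinite (UNIV - {0::complex})" using infinite_UNIV_char_0 by (rule infinite_remove)
  ultimately have "infinite {z. poly Q z = 0}" using infinite_super by blast
  then have "Q = 0" using poly_roots_finite by blast
  then have "0 = coeff Q (nat (c + K))" by simp
  also have "\<dots> = (\<Sum>m\<in>S. if e m = c then a m else 0)"
    unfolding Q_def coeff_sum coeff_monom using K Kc by (intro sum.cong refl) (auto simp: nat_eq_iff)
  also have "\<dots> = (\<Sum>m\<in>{m \<in> S. e m = c}. a m)"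
    using fin by (simp add: sum.inter_filter)
  finally show ?thesis by simp
qed

text \<open>With the other variables fixed, the one-variable case extracts the coefficient of a
  power of the last variable; the induction hypothesis treats that coefficient.\<close>

lemma laurent_coeff_zero_multi:
  fixes a :: "'m \<Rightarrow> complex" and n :: nat
  assumes fin: "finite S"
    and zero: "\<forall>s. (\<forall>i<n. s i \<noteq> 0) \<longrightarrow> (\<Sum>m\<in>S. a m * (\<Prod>i<n. s i powi e m i)) = 0"
  shows "(\<Sum>m\<in>{m \<in> S. \<forall>i<n. e m i = c i}. a m) = 0"
  using assms
proof (induction n arbitrary: S)
  case 0
  then show ?case by simp
next
  case (Suc n)
  have "(\<Sum>m\<in>{m \<in> {m \<in> S. e m n = c n}. \<forall>i<n. e m i = c i}. a m) = 0"
  proof (rule Suc.IH)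
    show "finite {m \<in> S. e m n = c n}" using Suc.prems by simp
    show "\<forall>s. (\<forall>i<n. s i \<noteq> 0) \<longrightarrow> (\<Sum>m\<in>{m \<in> S. e m n = c n}. a m * (\<Prod>i<n. s i powi e m i)) = 0"
    proof (intro allI impI)
      fix s :: "nat \<Rightarrow> complex" assume s: "\<forall>i<n. s i \<noteq> 0"
      show "(\<Sum>m\<in>{m \<in> S. e m n = c n}. a m * (\<Prod>i<n. s i powi e m i)) = 0"
      proof (rule laurent_coeff_zero[OF Suc.prems(1)])
        fix z :: complex assume "z \<noteq> 0"
        then have "(\<Sum>m\<in>S. a m * (\<Prod>i<Suc n. (s(n := z)) i powi e m i)) = 0"
          using s by (intro Suc.prems(2)[rule_format]) auto
        moreover have "(\<Prod>i<n. (s(n := z)) i powi e m i) = (\<Prod>i<n. s i powi e m i)" for m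
          by (intro prod.cong) auto
        ultimately show "(\<Sum>m\<in>S. a m * (\<Prod>i<n. s i powi e m i) * z powi e m n) = 0"
          by (simp add: mult.assoc)
      qed
    qed
  qed
  moreover have "{m \<in> {m \<in> S. e m n = c n}. \<forall>i<n. e m i = c i} = {m \<in> S. \<forall>i<Suc n. e m i = c i}"
    by (auto simp: less_Suc_eq)
  ultimately show ?case by simp
qed

section \<open>Supports and additive maps of bivariate polynomials\<close>

definition supp2 :: "int poly poly \<Rightarrow> (nat \<times> nat) set" where
  "supp2 F = {(i, j). coeff (coeff F j) i \<noteq> 0}"

text \<open>The additive map determined by its values on the monomials x^i y^j. It carries
  identities of bivariate polynomials to other rings, although \<open>E\<close> need not be
  multiplicative.\<close>

definition lin_ext :: "(nat \<Rightarrow> nat \<Rightarrow> 'a::comm_ring_1) \<Rightarrow> int poly poly \<Rightarrow> 'a" where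
  "lin_ext E F = (\<Sum>(i, j)\<in>supp2 F. of_int (coeff (coeff F j) i) * E i j)"

lemma finite_supp2: "finite (supp2 F)"
proof (rule finite_subset)
  show "supp2 F \<subseteq> (\<lambda>(j, i). (i, j)) ` (SIGMA j:{..degree F}. {..degree (coeff F j)})"
  proof
    fix v assume "v \<in> supp2 F"
    then obtain i j where v: "v = (i, j)" "coeff (coeff F j) i \<noteq> 0" by (auto simp: supp2_def)
    then have "i \<le> degree (coeff F j)" "j \<le> degree F" by (auto intro!: le_degree)
    then show "v \<in> (\<lambda>(j, i). (i, j)) ` (SIGMA j:{..degree F}. {..degree (coeff F j)})"
      using v by (auto intro!: image_eqI[where x = "(j, i)"])
  qed
qed auto

lemma lin_ext_superset:
  assumes "finite S" "supp2 F \<subseteq> S"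
  shows "lin_ext E F = (\<Sum>(i, j)\<in>S. of_int (coeff (coeff F j) i) * E i j)"
  unfolding lin_ext_def by (rule sum.mono_neutral_left) (use assms in \<open>auto simp: supp2_def\<close>)

lemma lin_ext_add: "lin_ext E (F + G) = lin_ext E F + lin_ext E G"
proof -
  let ?S = "supp2 F \<union> supp2 G"
  have "supp2 (F + G) \<subseteq> ?S" by (auto simp: supp2_def)
  then show ?thesis
    using finite_supp2[of F] finite_supp2[of G]
    by (simp add: lin_ext_superset[of ?S] sum.distrib[symmetric] split_def distrib_right)
qed

lemma lin_ext_sum: "lin_ext E (\<Sum>x\<in>X. f x) = (\<Sum>x\<in>X. lin_ext E (f x))"
  by (induction X rule: infinite_finite_induct) (simp_all add: lin_ext_add lin_ext_def[of _ 0] supp2_def)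

lemma lin_ext_monom: "lin_ext E (monom (monom a i) j) = of_int a * E i j"
proof -
  have "supp2 (monom (monom a i) j) \<subseteq> {(i, j)}" by (auto simp: supp2_def coeff_monom split: if_splits)
  then show ?thesis by (simp add: lin_ext_superset[of "{(i, j)}"])
qed

lemma supp2_decomp: "F = (\<Sum>(i, j)\<in>supp2 F. monom (monom (coeff (coeff F j) i) i) j)"
proof (rule poly_eqI, rule poly_eqI)
  fix j i
  have "coeff (coeff (\<Sum>(i, j)\<in>supp2 F. monom (monom (coeff (coeff F j) i) i) j) j) i =
      (\<Sum>v\<in>supp2 F. if v = (i, j) then coeff (coeff F j) i else 0)"
    unfolding coeff_sum by (intro sum.cong refl) (auto simp: coeff_monom split: if_splits)
  also have "\<dots> = coeff (coeff F j) i" using finite_supp2 by (simp add: supp2_def)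
  finally show "coeff (coeff F j) i =
      coeff (coeff (\<Sum>(i, j)\<in>supp2 F. monom (monom (coeff (coeff F j) i) i) j) j) i" ..
qed

lemma lin_ext_mult:
  "lin_ext E (F * G) = (\<Sum>(i, j)\<in>supp2 F. \<Sum>(i', j')\<in>supp2 G.
     of_int (coeff (coeff F j) i) * of_int (coeff (coeff G j') i') * E (i + i') (j + j'))"
proof -
  have "F * G = (\<Sum>(i, j)\<in>supp2 F. \<Sum>(i', j')\<in>supp2 G.
     monom (monom (coeff (coeff F j) i * coeff (coeff G j') i') (i + i')) (j + j'))"
    by (subst supp2_decomp[of F], subst supp2_decomp[of G])
      (simp add: sum_product split_def mult_monom)
  then show ?thesis by (simp add: lin_ext_sum split_def lin_ext_monom)
qed

lemma eval2_sum: "eval2 (\<Sum>x\<in>X. f x) x0 y = (\<Sum>x\<in>X. eval2 (f x) x0 y)"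
proof -
  have "eval2 0 x0 y = 0" by (simp add: eval2_def)
  then show ?thesis by (induction X rule: infinite_finite_induct) (simp_all add: eval2_add)
qed

lemma eval2_monom: "eval2 (monom (monom a i) j) x y = of_int a * x ^ i * y ^ j"
proof -
  interpret comm_ring_hom "\<lambda>a. poly (of_int_poly a) x" by (rule comm_ring_hom_eval)
  show ?thesis by (simp add: eval2_def map_poly_monom poly_monom)
qed

lemma line_if_infinite:
  assumes "infinite S" "\<And>x. x \<in> S \<Longrightarrow> eval2 F x (-1 - x) = 0"
  shows "poly F [:-1, -1:] = 0"
proof -
  have "poly (of_int_poly (poly F [:-1, -1:])) x = 0" if "x \<in> S" for x :: complex
    using eval2_poly[of F x "[:-1, -1:]"] assms(2)[OF that] by (simp add: map_poly_pCons hom_distribs)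
  then have "S \<subseteq> {x. poly (of_int_poly (poly F [:-1, -1:])) x = 0}" by auto
  then have "infinite {x :: complex. poly (of_int_poly (poly F [:-1, -1:])) x = 0}"
    using assms(1) infinite_super by blast
  then have "of_int_poly (poly F [:-1, -1:]) = (0 :: complex poly)" using poly_roots_finite by blast
  then show ?thesis by simp
qed

lemma keys_sum_single:
  assumes "finite S" "inj_on f S" "\<And>s. s \<in> S \<Longrightarrow> c s \<noteq> 0"
  shows "Poly_Mapping.keys (\<Sum>s\<in>S. Poly_Mapping.single (f s) (c s)) = f ` S"
proof -
  have "Poly_Mapping.lookup (\<Sum>s\<in>S. Poly_Mapping.single (f s) (c s)) (f t) = c t" if "t \<in> S" for t
  proof -
    have "Poly_Mapping.lookup (\<Sum>s\<in>S. Poly_Mapping.single (f s) (c s)) (f t) =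
        (\<Sum>s\<in>S. if s = t then c s else 0)"
      unfolding lookup_sum lookup_single when_def
      using assms(2) that by (intro sum.cong refl) (auto simp: inj_on_def)
    then show ?thesis using assms(1) that by simp
  qed
  then have "f ` S \<subseteq> Poly_Mapping.keys (\<Sum>s\<in>S. Poly_Mapping.single (f s) (c s))"
    using assms(3) by (auto simp: in_keys_iff)
  moreover have "Poly_Mapping.keys (\<Sum>s\<in>S. Poly_Mapping.single (f s) (c s)) \<subseteq> f ` S"
    by (rule subset_trans[OF keys_sum]) auto
  ultimately show ?thesis by blast
qed

text \<open>Degree bound and coset put the exponents in the triangle. A second term exists since
  y^idx alone would restrict to the nonzero polynomial (-1 - x)^idx, whereas the norm vanishes on
  the line.\<close>

lemma (in hermite_lattice) card_supp2_norm_poly: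
  "card (supp2 norm_poly) \<le> card triangle" "card (supp2 norm_poly) \<ge> 2"
proof -
  have "(\<lambda>(i, j). (int i, int j)) ` supp2 norm_poly \<subseteq> triangle"
    using norm_poly_graded by (fastforce simp: graded_def supp2_def triangle_def)
  moreover have "inj_on (\<lambda>(i, j). (int i, int j)) (supp2 norm_poly)" by (auto simp: inj_on_def)
  ultimately show "card (supp2 norm_poly) \<le> card triangle"
    using card_inj_on_le finite_triangle by blast
  have lead: "coeff norm_poly idx = 1" using norm_poly_monic by simp
  then have mem: "(0, idx) \<in> supp2 norm_poly" by (simp add: supp2_def)
  show "card (supp2 norm_poly) \<ge> 2"
  proof (rule ccontr)
    assume "\<not> 2 \<le> card (supp2 norm_poly)"
    then have "card (supp2 norm_poly) \<le> Suc 0" by simp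
    then have single: "supp2 norm_poly = {(0, idx)}"
      using mem finite_supp2 card_le_Suc0_iff_eq by blast
    have "norm_poly = monom 1 idx"
      by (subst supp2_decomp) (simp add: single lead monom_0 pCons_one)
    then have "[:-1, -1:] ^ idx = (0 :: int poly)" using norm_poly_line by (simp add: poly_monom)
    then show False by simp
  qed
qed

section \<open>The discriminant locus\<close>

lemma mpoly_eval_map_int:
  assumes "mpoly_vars_in N P"
  shows "mpoly_eval (mpoly_map_int P) X =
    (\<Sum>m\<in>Poly_Mapping.keys P. of_int (Poly_Mapping.lookup P m) * (\<Prod>k<N. X k ^ Poly_Mapping.lookup m k))"
proof -
  have lk: "Poly_Mapping.lookup (mpoly_map_int P) m = of_int (Poly_Mapping.lookup P m)" for m
    by (simp add: mpoly_map_int_def Poly_Mapping.map.rep_eq when_def)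
  then have "Poly_Mapping.keys (mpoly_map_int P) = Poly_Mapping.keys P"
    by (auto simp: in_keys_iff)
  moreover have "(\<Prod>i\<in>Poly_Mapping.keys m. X i ^ Poly_Mapping.lookup m i) = (\<Prod>k<N. X k ^ Poly_Mapping.lookup m k)"
    if "m \<in> Poly_Mapping.keys P" for m
    by (rule prod.mono_neutral_left) (use assms that in \<open>auto simp: mpoly_vars_in_def in_keys_iff\<close>)
  ultimately show ?thesis by (simp add: mpoly_eval_def lk)
qed

lemma prod_power_int_exponents:
  fixes s :: "'a::field"
  assumes "s \<noteq> 0" shows "(\<Prod>k\<in>K. s powi f k) = s powi (\<Sum>k\<in>K. f k)"
  using assms by (induction K rule: infinite_finite_induct) (auto simp: power_int_add)

lemma prod_lessThan_add: "(\<Prod>k<m + n. f k) = (\<Prod>k<m. f k) * (\<Prod>k<n. f (m + k :: nat))"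
  by (induction n) (simp_all add: mult.assoc)

definition val2 :: "nat \<times> nat \<Rightarrow> int \<times> int" where
  "val2 v = (int (fst v), int (snd v))"

text \<open>\<open>Lam_iff\<close> ties the normal form to the configuration: \<open>Lam\<close>
  collects the entries at the rows c1 and c2 of the integer combinations of the columns of
  B.\<close>

locale cayley_config = hermite_lattice d g e for d g :: nat and e :: int +
  fixes r :: nat and b :: "nat \<Rightarrow> int \<times> int" and c1 c2 :: "int \<times> int"
    and A :: "nat \<Rightarrow> nat \<Rightarrow> int"
  assumes b_nz: "\<forall>i\<in>{1..r}. b i \<noteq> 0"
    and c_det: "det2 c1 c2 \<noteq> 0"
    and homog: "\<exists>w :: nat \<Rightarrow> rat. \<forall>k<2*r+3. (\<Sum>i<2*r+1. w i * of_int (A i k)) = 1"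
    and B_ker: "\<forall>i<2*r+1. \<forall>j<(2::nat). (\<Sum>k<2*r+3. A i k * (if j = 0 then fst (B_row r b c1 c2 k) else snd (B_row r b c1 c2 k))) = 0"
    and B_gen: "\<forall>v :: nat \<Rightarrow> int. (\<forall>i<2*r+1. (\<Sum>k<2*r+3. A i k * v k) = 0) \<longrightarrow>
                 (\<exists>m n :: int. \<forall>k<2*r+3. v k = m * fst (B_row r b c1 c2 k) + n * snd (B_row r b c1 c2 k))"
    and Lam_iff: "v \<in> Lam \<longleftrightarrow>
       (\<exists>m. v = (fst c1 * fst m + snd c1 * snd m, fst c2 * fst m + snd c2 * snd m))"
begin

abbreviation N :: nat where "N \<equiv> 2 * r + 3"
abbreviation n :: nat where "n \<equiv> 2 * r + 1"
abbreviation row :: "nat \<Rightarrow> int \<times> int" where "row \<equiv> B_row r b c1 c2"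

section \<open>Exponent vectors and the kernel of A\<close>

definition pair :: "nat \<Rightarrow> int \<times> int \<Rightarrow> int" where
  "pair k m = fst (row k) * fst m + snd (row k) * snd m"

lemma row_simps:
  "row r = c1" "row (Suc r) = c2" "row (2 * r + 2) = - c1 - c2"
  "k < r \<Longrightarrow> row k = b (Suc k)" "k < r \<Longrightarrow> row (r + 2 + k) = - b (Suc k)"
  by (auto simp: B_row_def)

lemma row_nonzero: "k < N \<Longrightarrow> row k \<noteq> 0"
proof -
  assume "k < N"
  have c: "c1 \<noteq> 0" "c2 \<noteq> 0" using c_det by (auto simp: det2_def)
  have c12: "- c1 - c2 \<noteq> 0"
  proof
    assume "- c1 - c2 = 0"
    then have "c2 = - c1" by (metis add.inverse_inverse eq_iff_diff_eq_0)
    then show False using c_det by (simp add: det2_def)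
  qed
  consider "k < r" | "k = r" | "k = Suc r" | l where "l < r" "k = r + 2 + l" | "k = 2 * r + 2"
  proof -
    have "k < r \<or> k = r \<or> k = Suc r \<or> (k - (r + 2) < r \<and> k = r + 2 + (k - (r + 2))) \<or> k = 2 * r + 2"
      using \<open>k < N\<close> by linarith
    then show ?thesis using that by blast
  qed
  then show "row k \<noteq> 0"
    by cases (use b_nz c c12 row_simps in simp_all)
qed

lemma pair_simps:
  "pair (2 * r + 2) m = - pair r m - pair (Suc r) m"
  "k < r \<Longrightarrow> pair (r + 2 + k) m = - pair k m"
  by (simp only: pair_def row_simps, simp add: algebra_simps)+

lemma pair_add: "pair k (m + m') = pair k m + pair k m'"
  by (simp add: pair_def algebra_simps)

lemma Lam_pair_iff: "v \<in> Lam \<longleftrightarrow> (\<exists>m. v = (pair r m, pair (Suc r) m))"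
  by (simp add: Lam_iff pair_def row_simps)

text \<open>Cramer's rule recovers m from its pairings with c1 and c2; the divisions are exact on
  \<open>Lam\<close>.\<close>

definition mu :: "int \<times> int \<Rightarrow> int \<times> int" where
  "mu v = ((snd c2 * fst v - snd c1 * snd v) div det2 c1 c2,
           (fst c1 * snd v - fst c2 * fst v) div det2 c1 c2)"

lemma mu_pair: "mu (pair r m, pair (Suc r) m) = m"
proof -
  have "snd c2 * pair r m - snd c1 * pair (Suc r) m = det2 c1 c2 * fst m"
    "fst c1 * pair (Suc r) m - fst c2 * pair r m = det2 c1 c2 * snd m"
    by (simp_all add: pair_def row_simps det2_def algebra_simps)
  then show ?thesis using c_det by (simp add: mu_def)
qed

text \<open>For v in \<open>Lam\<close> this is entry k of the unique integer combination of the
  columns of B with entries v at the rows c1 and c2. It lifts an exponent shift in x, y to all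
  variables.\<close>

definition expn :: "nat \<Rightarrow> int \<times> int \<Rightarrow> int" where
  "expn k v = pair k (mu v)"

lemma expn_add:
  assumes "u \<in> Lam" "v \<in> Lam" shows "expn k (u + v) = expn k u + expn k v"
proof -
  obtain m m' where "u = (pair r m, pair (Suc r) m)" "v = (pair r m', pair (Suc r) m')"
    using assms unfolding Lam_pair_iff by blast
  moreover from this have "u + v = (pair r (m + m'), pair (Suc r) (m + m'))"
    by (simp add: pair_add)
  ultimately have "mu u = m" "mu v = m'" "mu (u + v) = m + m'"
    using mu_pair by metis+
  then show ?thesis by (simp only: expn_def pair_add)
qed

lemma expn_Lam: "v \<in> Lam \<Longrightarrow> expn r v = fst v" "v \<in> Lam \<Longrightarrow> expn (Suc r) v = snd v"
  by (auto simp: Lam_pair_iff expn_def mu_pair)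

text \<open>The value 0 beyond \<open>n\<close> makes equality of functions the same as equality of
  multidegrees.\<close>

definition Adeg :: "(nat \<Rightarrow>\<^sub>0 nat) \<Rightarrow> nat \<Rightarrow> int" where
  "Adeg m = (\<lambda>i. if i < n then \<Sum>k<N. A i k * int (Poly_Mapping.lookup m k) else 0)"

lemma Adeg_eq:
  assumes "Adeg m = Adeg m'"
  obtains w where "\<And>k. k < N \<Longrightarrow> int (Poly_Mapping.lookup m k) = int (Poly_Mapping.lookup m' k) + pair k w"
proof -
  have "\<forall>i<n. (\<Sum>k<N. A i k * (int (Poly_Mapping.lookup m k) - int (Poly_Mapping.lookup m' k))) = 0"
  proof (intro allI impI)
    fix i assume "i < n"
    then have "(\<Sum>k<N. A i k * int (Poly_Mapping.lookup m k)) = (\<Sum>k<N. A i k * int (Poly_Mapping.lookup m' k))"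
      using fun_cong[OF assms, of i] by (simp only: Adeg_def if_True)
    then show "(\<Sum>k<N. A i k * (int (Poly_Mapping.lookup m k) - int (Poly_Mapping.lookup m' k))) = 0"
      by (simp only: right_diff_distrib sum_subtractf)
  qed
  from B_gen[rule_format, OF this[rule_format]] obtain x y where
    "\<forall>k<N. int (Poly_Mapping.lookup m k) - int (Poly_Mapping.lookup m' k) = x * fst (row k) + y * snd (row k)"
    by blast
  then have "int (Poly_Mapping.lookup m k) = int (Poly_Mapping.lookup m' k) + pair k (x, y)" if "k < N" for k
    using that by (auto simp: pair_def algebra_simps)
  then show ?thesis using that by blast
qed

definition pos :: "(nat \<Rightarrow>\<^sub>0 nat) \<Rightarrow> nat \<times> nat" where
  "pos m = (Poly_Mapping.lookup m r, Poly_Mapping.lookup m (Suc r))"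

text \<open>Exponents of equal A-degree differ by a kernel vector, which is determined by its
  entries at c1 and c2. So within one degree the exponents of two variables determine all
  others.\<close>

lemma Adeg_eq_expn:
  assumes "Adeg m = Adeg m'"
  shows "val2 (pos m) - val2 (pos m') \<in> Lam"
    "k < N \<Longrightarrow> int (Poly_Mapping.lookup m k) =
       int (Poly_Mapping.lookup m' k) + expn k (val2 (pos m) - val2 (pos m'))"
proof -
  obtain w where w: "\<And>k. k < N \<Longrightarrow> int (Poly_Mapping.lookup m k) = int (Poly_Mapping.lookup m' k) + pair k w"
    using Adeg_eq[OF assms] by blast
  have eq: "val2 (pos m) - val2 (pos m') = (pair r w, pair (Suc r) w)"
    using w[of r] w[of "Suc r"] by (simp add: val2_def pos_def)
  show "val2 (pos m) - val2 (pos m') \<in> Lam" unfolding eq Lam_pair_iff by blast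
  show "k < N \<Longrightarrow> int (Poly_Mapping.lookup m k) =
       int (Poly_Mapping.lookup m' k) + expn k (val2 (pos m) - val2 (pos m'))"
    unfolding eq expn_def mu_pair by (rule w)
qed

section \<open>The Horn-Kapranov parametrization\<close>

definition lform :: "nat \<Rightarrow> complex \<times> complex \<Rightarrow> complex" where
  "lform k t = of_int (fst (row k)) * fst t + of_int (snd (row k)) * snd t"

definition point :: "complex \<times> complex \<Rightarrow> (nat \<Rightarrow> complex) \<Rightarrow> nat \<Rightarrow> complex" where
  "point t s k = (if k < N then lform k t * (\<Prod>i<n. s i powi (- A i k)) else 0)"

lemma A_lform_sum:
  assumes "j < n" shows "(\<Sum>k<N. of_int (A j k) * lform k t) = 0"
proof -
  have f: "(\<Sum>k<N. A j k * fst (row k)) = 0" and s: "(\<Sum>k<N. A j k * snd (row k)) = 0"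
    using B_ker[rule_format, OF assms, of 0] B_ker[rule_format, OF assms, of 1] by simp_all
  have "(\<Sum>k<N. of_int (A j k) * lform k t) =
      of_int (\<Sum>k<N. A j k * fst (row k)) * fst t + of_int (\<Sum>k<N. A j k * snd (row k)) * snd t"
    by (simp only: lform_def distrib_left sum.distrib of_int_sum of_int_mult sum_distrib_right mult.assoc)
  then show ?thesis by (simp only: f s) simp
qed

text \<open>Applying w to A v = 0 gives the sum of the entries of v, as w takes the value 1 on every
  column of A. Both columns of B are such v.\<close>

lemma row_sum: "(\<Sum>k<N. row k) = 0"
proof -
  obtain w :: "nat \<Rightarrow> rat" where w: "\<And>k. k < N \<Longrightarrow> (\<Sum>i<n. w i * of_int (A i k)) = 1"
    using homog by blast
  have "(\<Sum>k<N. f k) = 0" if f: "\<And>i. i < n \<Longrightarrow> (\<Sum>k<N. A i k * f k) = 0" for f :: "nat \<Rightarrow> int"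
  proof -
    have "(of_int (\<Sum>k<N. f k) :: rat) = (\<Sum>k<N. (\<Sum>i<n. w i * of_int (A i k)) * of_int (f k))"
      unfolding of_int_sum by (intro sum.cong refl) (simp only: w lessThan_iff mult_1)
    also have "\<dots> = (\<Sum>i<n. w i * of_int (\<Sum>k<N. A i k * f k))"
      unfolding sum_distrib_right sum_distrib_left of_int_sum of_int_mult mult.assoc by (rule sum.swap)
    also have "\<dots> = (\<Sum>i<n. w i * of_int 0)"
      by (intro sum.cong refl) (simp only: f lessThan_iff)
    finally show ?thesis by (simp only: of_int_eq_0_iff mult_zero_right sum.neutral_const of_int_0)
  qed
  from this[of "\<lambda>k. fst (row k)"] this[of "\<lambda>k. snd (row k)"]
  have "(\<Sum>k<N. fst (row k)) = 0" "(\<Sum>k<N. snd (row k)) = 0"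
    using B_ker[rule_format, of _ 0] B_ker[rule_format, of _ 1] by simp_all
  then show ?thesis by (simp only: prod_eq_iff fst_sum snd_sum fst_zero snd_zero simp_thms)
qed

lemma lform_sum: "(\<Sum>k<N. lform k t) = 0"
proof -
  have "(\<Sum>k<N. lform k t) = of_int (fst (\<Sum>k<N. row k)) * fst t + of_int (snd (\<Sum>k<N. row k)) * snd t"
    by (simp only: lform_def fst_sum snd_sum of_int_sum sum_distrib_right sum.distrib)
  then show ?thesis by (simp only: row_sum) simp
qed

text \<open>At the root s, term k of f equals \<open>lform k t\<close>. These forms sum to 0, and
  the logarithmic derivatives vanish because the vector of forms lies in the kernel of A.\<close>

lemma point_in_disc_set:
  assumes t: "\<And>k. k < N \<Longrightarrow> lform k t \<noteq> 0" and s: "\<And>i. i < n \<Longrightarrow> s i \<noteq> 0"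
  shows "point t s \<in> disc_set n N A"
proof -
  have nz: "\<forall>k<N. point t s k \<noteq> 0" using t s by (auto simp: point_def power_int_eq_0_iff)
  have "laurent_f n N A (point t s) s = (\<Sum>k<N. lform k t)"
    unfolding laurent_f_def
  proof (intro sum.cong refl)
    fix k assume "k \<in> {..<N}"
    moreover have "(\<Prod>i<n. s i powi (- A i k)) * (\<Prod>i<n. s i powi A i k) = 1"
      unfolding prod.distrib[symmetric] using s
      by (intro prod.neutral) (auto simp: power_int_minus power_int_eq_0_iff)
    ultimately show "point t s k * (\<Prod>i<n. s i powi A i k) = lform k t"
      by (simp only: point_def lessThan_iff if_True mult.assoc) simp
  qed
  then have f0: "laurent_f n N A (point t s) s = 0" by (simp only: lform_sum)
  have d0: "laurent_f_deriv n N A j (point t s) s = 0" if j: "j < n" for j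
  proof -
    have "laurent_f_deriv n N A j (point t s) s =
        (\<Sum>k<N. (\<Prod>i<n. s i powi (- (if i = j then 1 else 0))) * (of_int (A j k) * lform k t))"
      unfolding laurent_f_deriv_def
    proof (intro sum.cong refl)
      fix k assume k: "k \<in> {..<N}"
      have "(\<Prod>i<n. s i powi (- A i k)) * (\<Prod>i<n. s i powi (A i k - (if i = j then 1 else 0))) =
          (\<Prod>i<n. s i powi (- (if i = j then 1 else 0)))"
        unfolding prod.distrib[symmetric]
      proof (intro prod.cong refl)
        fix i assume "i \<in> {..<n}"
        then have "s i \<noteq> 0" using s by blast
        then show "s i powi (- A i k) * s i powi (A i k - (if i = j then 1 else 0)) =
            s i powi (- (if i = j then 1 else 0))"
          by (subst power_int_add[symmetric]) auto
      qed
      then show "point t s k * of_int (A j k) * (\<Prod>i<n. s i powi (A i k - (if i = j then 1 else 0))) =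
          (\<Prod>i<n. s i powi (- (if i = j then 1 else 0))) * (of_int (A j k) * lform k t)"
        using k by (simp only: point_def lessThan_iff if_True mult_ac)
    qed
    also have "\<dots> = 0" unfolding sum_distrib_left[symmetric] A_lform_sum[OF j] by (rule mult_zero_right)
    finally show ?thesis .
  qed
  show ?thesis unfolding disc_set_def pts_def
    using nz f0 d0 s by (auto simp: point_def)
qed

text \<open>Along the torus the term with exponent m is multiplied by s^(-A m). Distinct A-degrees
  give distinct Laurent monomials in s, so each graded component vanishes by itself.\<close>

lemma component_vanishes:
  assumes vars: "mpoly_vars_in N P"
    and van: "\<forall>X\<in>disc_set n N A. mpoly_eval (mpoly_map_int P) X = 0"
    and t: "\<And>k. k < N \<Longrightarrow> lform k t \<noteq> 0"
  shows "(\<Sum>m\<in>{m \<in> Poly_Mapping.keys P. Adeg m = Adeg m0}.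
     of_int (Poly_Mapping.lookup P m) * (\<Prod>k<N. lform k t ^ Poly_Mapping.lookup m k)) = 0"
proof -
  let ?a = "\<lambda>m. of_int (Poly_Mapping.lookup P m) * (\<Prod>k<N. lform k t ^ Poly_Mapping.lookup m k)"
  have "(\<Sum>m\<in>{m \<in> Poly_Mapping.keys P. \<forall>i<n. - Adeg m i = - Adeg m0 i}. ?a m) = 0"
  proof (rule laurent_coeff_zero_multi[OF finite_keys], intro allI impI)
    fix s :: "nat \<Rightarrow> complex" assume s: "\<forall>i<n. s i \<noteq> 0"
    have "(\<Prod>k<N. point t s k ^ Poly_Mapping.lookup m k) =
        (\<Prod>k<N. lform k t ^ Poly_Mapping.lookup m k) * (\<Prod>i<n. s i powi (- Adeg m i))" for m
    proof -
      have "(\<Prod>k<N. point t s k ^ Poly_Mapping.lookup m k) =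
          (\<Prod>k<N. lform k t ^ Poly_Mapping.lookup m k * (\<Prod>i<n. s i powi (- A i k * int (Poly_Mapping.lookup m k))))"
        by (intro prod.cong refl)
          (simp only: point_def lessThan_iff if_True power_mult_distrib prod_power_distrib power_int_mult power_int_of_nat)
      also have "\<dots> = (\<Prod>k<N. lform k t ^ Poly_Mapping.lookup m k) *
          (\<Prod>i<n. \<Prod>k<N. s i powi (- A i k * int (Poly_Mapping.lookup m k)))"
        unfolding prod.distrib by (subst prod.swap) (rule refl)
      also have "(\<Prod>i<n. \<Prod>k<N. s i powi (- A i k * int (Poly_Mapping.lookup m k))) = (\<Prod>i<n. s i powi (- Adeg m i))"
      proof (intro prod.cong refl)
        fix i assume i: "i \<in> {..<n}"
        then have "s i \<noteq> 0" using s by blast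
        then show "(\<Prod>k<N. s i powi (- A i k * int (Poly_Mapping.lookup m k))) = s i powi (- Adeg m i)"
          using i by (subst prod_power_int_exponents)
            (simp_all only: Adeg_def lessThan_iff if_True sum_negf mult_minus_left not_False_eq_True)
      qed
      finally show ?thesis .
    qed
    then have "(\<Sum>m\<in>Poly_Mapping.keys P. ?a m * (\<Prod>i<n. s i powi (- Adeg m i))) =
        mpoly_eval (mpoly_map_int P) (point t s)"
      unfolding mpoly_eval_map_int[OF vars] by (simp only: mult.assoc)
    also have "\<dots> = 0" by (rule van[rule_format], rule point_in_disc_set) (use t s in auto)
    finally show "(\<Sum>m\<in>Poly_Mapping.keys P. ?a m * (\<Prod>i<n. s i powi (- Adeg m i))) = 0" .
  qed
  moreover have "(\<forall>i<n. - Adeg m i = - Adeg m0 i) \<longleftrightarrow> Adeg m = Adeg m0" for m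
    by (auto simp: fun_eq_iff Adeg_def)
  ultimately show ?thesis by (simp only:)
qed

text \<open>Cramer's rule for the t that pairs to x with c1 and to -1 - x with c2; the last row then
  pairs to 1.\<close>

definition line_pt :: "complex \<Rightarrow> complex \<times> complex" where
  "line_pt x = ((of_int (snd c2) * x - of_int (snd c1) * (-1 - x)) / of_int (det2 c1 c2),
                (of_int (fst c1) * (-1 - x) - of_int (fst c2) * x) / of_int (det2 c1 c2))"

lemma det2_complex: "of_int (det2 c1 c2) \<noteq> (0::complex)"
  using c_det by simp

lemma lform_line_pt:
  "lform r (line_pt x) = x" "lform (Suc r) (line_pt x) = -1 - x" "lform (2 * r + 2) (line_pt x) = 1"
proof -
  show 1: "lform r (line_pt x) = x" and 2: "lform (Suc r) (line_pt x) = -1 - x"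
    using det2_complex unfolding lform_def line_pt_def row_simps fst_conv snd_conv times_divide_eq_right
      add_divide_distrib[symmetric]
    by (simp_all only: divide_eq_eq) (simp_all add: det2_def algebra_simps)
  have "lform (2 * r + 2) t = - lform r t - lform (Suc r) t" for t
    unfolding lform_def row_simps by (simp add: algebra_simps)
  then show "lform (2 * r + 2) (line_pt x) = 1" by (simp only: 1 2) simp
qed

lemma lform_neg: "k < r \<Longrightarrow> lform (r + 2 + k) t = - lform k t"
  by (simp only: lform_def row_simps, simp add: algebra_simps)

text \<open>The form is affine in x. If it were identically 0, row k would be parallel to both c1
  and c2, hence 0, which \<open>row_nonzero\<close> excludes.\<close>

lemma finite_lform_zeros:
  assumes "k < N" shows "finite {x. lform k (line_pt x) = 0}"
proof -
  define u where "u = fst (row k) * (snd c2 + snd c1) - snd (row k) * (fst c1 + fst c2)"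
  define v where "v = fst (row k) * snd c1 - snd (row k) * fst c1"
  have "lform k (line_pt x) = poly [:of_int v, of_int u:] x / of_int (det2 c1 c2)" for x
    unfolding lform_def line_pt_def u_def v_def fst_conv snd_conv times_divide_eq_right
      add_divide_distrib[symmetric] by (simp add: algebra_simps)
  then have "{x. lform k (line_pt x) = 0} = {x. poly [:of_int v, of_int u:] x = (0::complex)}"
    using det2_complex by simp
  moreover have "[:of_int v, of_int u:] \<noteq> (0 :: complex poly)"
  proof
    assume "[:of_int v, of_int u:] = (0 :: complex poly)"
    then have "v = 0" "u = 0" by simp_all
    then have e1: "fst (row k) * snd c1 = snd (row k) * fst c1" and e2: "fst (row k) * snd c2 = snd (row k) * fst c2"
      by (simp_all add: u_def v_def algebra_simps)
    have "det2 c1 c2 * fst (row k) = fst c1 * (fst (row k) * snd c2) - fst c2 * (fst (row k) * snd c1)"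
      by (simp add: det2_def algebra_simps)
    then have "det2 c1 c2 * fst (row k) = 0" unfolding e1 e2 by simp
    moreover have "det2 c1 c2 * snd (row k) = snd c2 * (snd (row k) * fst c1) - snd c1 * (snd (row k) * fst c2)"
      by (simp add: det2_def algebra_simps)
    then have "det2 c1 c2 * snd (row k) = 0" unfolding e1[symmetric] e2[symmetric] by simp
    ultimately show False using c_det row_nonzero[OF assms] by (simp add: prod_eq_iff)
  qed
  ultimately show ?thesis using poly_roots_finite by metis
qed

definition generic :: "complex set" where
  "generic = {x. \<forall>k<N. lform k (line_pt x) \<noteq> 0}"

lemma infinite_generic: "infinite generic"
proof -
  have "UNIV - generic = (\<Union>k<N. {x. lform k (line_pt x) = 0})" by (auto simp: generic_def)
  then have "finite (UNIV - generic)" using finite_lform_zeros by (simp only:) blast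
  then show ?thesis using infinite_UNIV_char_0 Diff_infinite_finite by (metis finite_Diff2)
qed

text \<open>The sign left over when powers of the forms of the negated rows are written in the forms
  of the b_k.\<close>

definition sgnm :: "(nat \<Rightarrow>\<^sub>0 nat) \<Rightarrow> int" where
  "sgnm m = (-1) ^ (\<Sum>k<r. Poly_Mapping.lookup m (r + 2 + k))"

lemma sgnm_add: "sgnm (m + m') = sgnm m * sgnm m'"
  by (simp add: sgnm_def lookup_add sum.distrib power_add)

lemma sgnm_square: "sgnm m * sgnm m = 1"
  by (simp add: sgnm_def power_add[symmetric])

lemma prod_lform_line_pt:
  "(\<Prod>k<N. lform k (line_pt x) ^ Poly_Mapping.lookup m k) =
   (\<Prod>k<r. lform k (line_pt x) ^ (Poly_Mapping.lookup m k + Poly_Mapping.lookup m (r + 2 + k))) *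
   (of_int (sgnm m) * x ^ fst (pos m) * (-1 - x) ^ snd (pos m))"
proof -
  let ?f = "\<lambda>k. lform k (line_pt x) ^ Poly_Mapping.lookup m k"
  have "(\<Prod>k<N. ?f k) = (\<Prod>k<Suc (r + 2 + r). ?f k)" by (rule arg_cong[where f = "\<lambda>n. prod ?f {..<n}"]) simp
  also have "\<dots> = (\<Prod>k<r. ?f k) * ?f r * ?f (Suc r) * (\<Prod>k<r. ?f (r + 2 + k)) * ?f (2 * r + 2)"
    unfolding prod.lessThan_Suc prod_lessThan_add[of ?f "r + 2" r]
    by (simp add: numeral_2_eq_2 mult_2)
  also have "(\<Prod>k<r. ?f (r + 2 + k)) = (\<Prod>k<r. (-1) ^ Poly_Mapping.lookup m (r + 2 + k) *
      lform k (line_pt x) ^ Poly_Mapping.lookup m (r + 2 + k))"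
    by (intro prod.cong refl) (simp only: lform_neg lessThan_iff power_mult_distrib[symmetric] mult_minus1)
  also have "\<dots> = of_int (sgnm m) * (\<Prod>k<r. lform k (line_pt x) ^ Poly_Mapping.lookup m (r + 2 + k))"
    by (simp add: prod.distrib sgnm_def power_sum)
  finally show ?thesis
    unfolding lform_line_pt pos_def fst_conv snd_conv power_one power_add prod.distrib
    by (simp only: mult_1 mult_1_right mult_ac)
qed

text \<open>One A-graded component in the variables x, y: the factors of the rows b_k and -b_k are
  stripped, only their sign is kept.\<close>

definition comp_poly :: "int mpoly \<Rightarrow> (nat \<Rightarrow>\<^sub>0 nat) \<Rightarrow> int poly poly" where
  "comp_poly P m0 = (\<Sum>m\<in>{m \<in> Poly_Mapping.keys P. Adeg m = Adeg m0}.
     monom (monom (Poly_Mapping.lookup P m * sgnm m) (fst (pos m))) (snd (pos m)))"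

lemma comp_poly_line:
  assumes vars: "mpoly_vars_in N P"
    and van: "\<forall>X\<in>disc_set n N A. mpoly_eval (mpoly_map_int P) X = 0"
  shows "poly (comp_poly P m0) [:-1, -1:] = 0"
proof (rule line_if_infinite[OF infinite_generic])
  fix x assume x: "x \<in> generic"
  let ?M = "{m \<in> Poly_Mapping.keys P. Adeg m = Adeg m0}"
  define C where "C = (\<Prod>k<r. lform k (line_pt x) ^ (Poly_Mapping.lookup m0 k + Poly_Mapping.lookup m0 (r + 2 + k)))"
  have "C \<noteq> 0" using x by (auto simp: C_def generic_def)
  \<comment> \<open>A kernel vector has opposite entries at b_k and -b_k, so the two exponents have
    a constant sum throughout the component and contribute one common factor.\<close>
  have const: "(\<Prod>k<r. lform k (line_pt x) ^ (Poly_Mapping.lookup m k + Poly_Mapping.lookup m (r + 2 + k))) = C"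
    if "m \<in> ?M" for m
    unfolding C_def
  proof (intro prod.cong refl)
    fix k assume k: "k \<in> {..<r}"
    obtain w where w: "\<And>k. k < N \<Longrightarrow> int (Poly_Mapping.lookup m k) = int (Poly_Mapping.lookup m0 k) + pair k w"
      using Adeg_eq \<open>m \<in> ?M\<close> by blast
    have "int (Poly_Mapping.lookup m k + Poly_Mapping.lookup m (r + 2 + k)) =
        int (Poly_Mapping.lookup m0 k + Poly_Mapping.lookup m0 (r + 2 + k))"
      using w[of k] w[of "r + 2 + k"] pair_simps(2)[of k w] k by simp
    then show "lform k (line_pt x) ^ (Poly_Mapping.lookup m k + Poly_Mapping.lookup m (r + 2 + k)) =
        lform k (line_pt x) ^ (Poly_Mapping.lookup m0 k + Poly_Mapping.lookup m0 (r + 2 + k))"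
      by (simp only: of_nat_eq_iff)
  qed
  have "0 = (\<Sum>m\<in>?M. of_int (Poly_Mapping.lookup P m) * (\<Prod>k<N. lform k (line_pt x) ^ Poly_Mapping.lookup m k))"
    using component_vanishes[OF vars van, of "line_pt x" m0] x by (simp add: generic_def)
  also have "\<dots> = (\<Sum>m\<in>?M. C * (of_int (Poly_Mapping.lookup P m * sgnm m) * x ^ fst (pos m) * (-1 - x) ^ snd (pos m)))"
  proof (intro sum.cong refl)
    fix m assume "m \<in> ?M"
    then show "of_int (Poly_Mapping.lookup P m) * (\<Prod>k<N. lform k (line_pt x) ^ Poly_Mapping.lookup m k) =
        C * (of_int (Poly_Mapping.lookup P m * sgnm m) * x ^ fst (pos m) * (-1 - x) ^ snd (pos m))"
      unfolding prod_lform_line_pt of_int_mult by (subst const) (simp_all only: mult_ac)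
  qed
  also have "\<dots> = C * eval2 (comp_poly P m0) x (-1 - x)"
    by (simp only: comp_poly_def eval2_sum eval2_monom sum_distrib_left)
  finally show "eval2 (comp_poly P m0) x (-1 - x) = 0" using \<open>C \<noteq> 0\<close> by simp
qed

lemma comp_poly_coset: "coset_supp (val2 (pos m0)) (comp_poly P m0)"
  unfolding coset_supp_def
proof (intro allI impI)
  fix i j assume "coeff (coeff (comp_poly P m0) j) i \<noteq> 0"
  then obtain m where m: "Adeg m = Adeg m0"
    "coeff (coeff (monom (monom (Poly_Mapping.lookup P m * sgnm m) (fst (pos m))) (snd (pos m))) j) i \<noteq> 0"
    unfolding comp_poly_def coeff_sum by (auto elim: sum.not_neutral_contains_not_neutral)
  then have "(i, j) = pos m" by (auto simp: coeff_monom prod_eq_iff split: if_splits)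
  then have "(int i, int j) = val2 (pos m)" by (metis val2_def fst_conv snd_conv)
  then show "(int i, int j) - val2 (pos m0) \<in> Lam" using Adeg_eq_expn(1)[OF m(1)] by simp
qed

section \<open>Lifting bivariate polynomials back to all variables\<close>

definition expo :: "(nat \<Rightarrow> int) \<Rightarrow> (nat \<Rightarrow>\<^sub>0 nat)" where
  "expo f = Abs_poly_mapping (\<lambda>k. if k < N then nat (f k) else 0)"

lemma lookup_expo: "Poly_Mapping.lookup (expo f) k = (if k < N then nat (f k) else 0)"
proof -
  have "finite {k. (if k < N then nat (f k) else 0) \<noteq> 0}"
    by (rule finite_subset[of _ "{..<N}"]) auto
  then show ?thesis unfolding expo_def by (subst lookup_Abs_poly_mapping) auto
qed

lemma expo_add:
  assumes "\<And>k. k < N \<Longrightarrow> 0 \<le> f k" "\<And>k. k < N \<Longrightarrow> 0 \<le> h k"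
  shows "expo (\<lambda>k. f k + h k) = expo f + expo h"
  by (intro poly_mapping_eqI) (use assms in \<open>simp add: lookup_add lookup_expo nat_add_distrib\<close>)

text \<open>The sign accounts for the negated rows \<open>- b k\<close> and makes \<open>smon\<close> correspond to a monic
  monomial in \<open>x, y\<close> under the parametrization.\<close>

definition smon :: "(nat \<Rightarrow> int) \<Rightarrow> int mpoly" where
  "smon f = Poly_Mapping.single (expo f) (sgnm (expo f))"

lemma smon_mult:
  assumes "\<And>k. k < N \<Longrightarrow> 0 \<le> f k" "\<And>k. k < N \<Longrightarrow> 0 \<le> h k"
  shows "smon f * smon h = smon (\<lambda>k. f k + h k)"
  using expo_add[of f h] assms by (simp add: smon_def mult_single sgnm_add)

definition bnd :: "(int \<times> int) set \<Rightarrow> nat \<Rightarrow> int" where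
  "bnd V k = (\<Sum>v\<in>V. \<bar>expn k v\<bar>)"

lemma bnd_nonneg: "0 \<le> bnd V k"
  by (simp add: bnd_def sum_nonneg)

lemma bnd_expn: "finite V \<Longrightarrow> v \<in> V \<Longrightarrow> 0 \<le> bnd V k + expn k v"
  using member_le_sum[of v V "\<lambda>v. \<bar>expn k v\<bar>"] by (simp add: bnd_def)

definition shiftH :: "nat \<Rightarrow> int" where
  "shiftH = bnd (val2 ` supp2 norm_poly)"

text \<open>The homogenized norm: exponents in x, y are lifted along the kernel of A, and
  \<open>shiftH\<close> clears the negative ones.\<close>

definition disc_lift :: "int mpoly" where
  "disc_lift = (\<Sum>(i, j)\<in>supp2 norm_poly. of_int (coeff (coeff norm_poly j) i) *
     smon (\<lambda>k. shiftH k + expn k (val2 (i, j))))"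

lemma supp2_norm_Lam: "v \<in> supp2 norm_poly \<Longrightarrow> val2 v \<in> Lam"
  using norm_poly_graded by (auto simp: graded_def supp2_def val2_def)

lemma shiftH_expn: "v \<in> supp2 norm_poly \<Longrightarrow> 0 \<le> shiftH k + expn k (val2 v)"
  unfolding shiftH_def by (rule bnd_expn) (auto simp: finite_supp2)

lemma sgnm_nonzero: "sgnm m \<noteq> 0"
  by (simp add: sgnm_def)

text \<open>No two terms merge: up to the shift, the entries at c1 and c2 return the exponents i and
  j.\<close>

lemma num_terms_disc_lift: "num_terms disc_lift = card (supp2 norm_poly)"
proof -
  let ?f = "\<lambda>v. expo (\<lambda>k. shiftH k + expn k (val2 v))"
  let ?c = "\<lambda>v. coeff (coeff norm_poly (snd v)) (fst v) * sgnm (?f v)"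
  have "disc_lift = (\<Sum>v\<in>supp2 norm_poly. Poly_Mapping.single (?f v) (?c v))"
    unfolding disc_lift_def smon_def
    by (intro sum.cong refl) (auto simp: mult_single simp flip: single_of_int)
  moreover have inj: "inj_on ?f (supp2 norm_poly)"
  proof (rule inj_onI)
    fix u v assume uv: "u \<in> supp2 norm_poly" "v \<in> supp2 norm_poly" and eq: "?f u = ?f v"
    have "nat (shiftH k + expn k (val2 u)) = nat (shiftH k + expn k (val2 v))" if "k < N" for k
      using arg_cong[OF eq, of "\<lambda>m. Poly_Mapping.lookup m k"] that by (simp only: lookup_expo if_True)
    then have "shiftH k + expn k (val2 u) = shiftH k + expn k (val2 v)" if "k < N" for k
      using that eq_nat_nat_iff[OF shiftH_expn[OF uv(1)] shiftH_expn[OF uv(2)], of k k] by blast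
    from this[of r] this[of "Suc r"] show "u = v"
      unfolding add_left_cancel expn_Lam[OF supp2_norm_Lam[OF uv(1)]] expn_Lam[OF supp2_norm_Lam[OF uv(2)]]
      by (simp add: val2_def prod_eq_iff)
  qed
  moreover have "?c v \<noteq> 0" if "v \<in> supp2 norm_poly" for v
    using that by (auto simp: supp2_def sgnm_nonzero)
  ultimately have "Poly_Mapping.keys disc_lift = ?f ` supp2 norm_poly"
    using keys_sum_single[OF finite_supp2 inj, of ?c] by simp
  then show ?thesis unfolding num_terms_def using card_image[OF inj] by simp
qed

text \<open>In x, y the component is the norm times some W. Lifting this factorization additively
  yields \<open>disc_lift\<close> times a lift of W; the monomial comes from the shifts that clear
  negative exponents.\<close>

lemma disc_lift_dvd_component:
  assumes vars: "mpoly_vars_in N P"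
    and van: "\<forall>X\<in>disc_set n N A. mpoly_eval (mpoly_map_int P) X = 0"
  shows "\<exists>\<beta>. disc_lift dvd Poly_Mapping.single \<beta> 1 *
     (\<Sum>m\<in>{m \<in> Poly_Mapping.keys P. Adeg m = Adeg m0}. Poly_Mapping.single m (Poly_Mapping.lookup P m))"
proof -
  let ?M = "{m \<in> Poly_Mapping.keys P. Adeg m = Adeg m0}"
  let ?c = "val2 (pos m0)"
  have "norm_poly dvd comp_poly P m0"
    by (rule norm_poly_dvd[OF comp_poly_coset comp_poly_line[OF vars van]])
  then obtain W where W: "comp_poly P m0 = norm_poly * W" by (elim dvdE)
  define S where "S = {v \<in> supp2 W. val2 v - ?c \<in> Lam}"
  define V where "V = (\<lambda>v. val2 v - ?c) ` S"
  have finS: "finite S" and finV: "finite V" unfolding S_def V_def using finite_supp2[of W] by auto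
  \<comment> \<open>\<open>m0\<close> is the base point of the coset; \<open>bnd V\<close> makes the
    lifted exponents nonnegative.\<close>
  define shiftG where "shiftG = (\<lambda>k. bnd V k + int (Poly_Mapping.lookup m0 k))"
  have shiftG: "0 \<le> shiftG k + expn k (val2 v - ?c)" if "v \<in> S" for k v
    using bnd_expn[OF finV, of "val2 v - ?c" k] that by (simp add: shiftG_def V_def)
  define G where "G = (\<Sum>(i, j)\<in>S. of_int (coeff (coeff W j) i) *
     smon (\<lambda>k. shiftG k + expn k (val2 (i, j) - ?c)))"
  \<comment> \<open>With the sum of both shifts, lifting is multiplicative on a norm term times a
    term indexed by \<open>S\<close>; the value 0 off the coset discards all other products.\<close>
  define E where "E = (\<lambda>i j. if val2 (i, j) - ?c \<in> Lam
     then smon (\<lambda>k. (shiftH k + shiftG k) + expn k (val2 (i, j) - ?c)) else 0)"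
  define \<beta> where "\<beta> = expo (\<lambda>k. shiftH k + bnd V k)"
  have shiftH0: "0 \<le> shiftH k" for k by (simp add: shiftH_def bnd_nonneg)
  have "lin_ext E (comp_poly P m0) = (\<Sum>m\<in>?M. of_int (Poly_Mapping.lookup P m * sgnm m) * E (fst (pos m)) (snd (pos m)))"
    unfolding comp_poly_def lin_ext_sum lin_ext_monom ..
  also have "\<dots> = (\<Sum>m\<in>?M. of_int (sgnm \<beta>) * (Poly_Mapping.single \<beta> 1 * Poly_Mapping.single m (Poly_Mapping.lookup P m)))"
  proof (intro sum.cong refl)
    fix m assume m: "m \<in> ?M"
    then have deg: "Adeg m = Adeg m0" and keys: "Poly_Mapping.keys m \<subseteq> {..<N}"
      using vars by (auto simp: mpoly_vars_in_def)
    have "expo (\<lambda>k. (shiftH k + shiftG k) + expn k (val2 (pos m) - ?c)) = \<beta> + m"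
    proof (rule poly_mapping_eqI)
      fix k
      show "Poly_Mapping.lookup (expo (\<lambda>k. (shiftH k + shiftG k) + expn k (val2 (pos m) - ?c))) k =
          Poly_Mapping.lookup (\<beta> + m) k"
      proof (cases "k < N")
        case True
        have "shiftH k + shiftG k + expn k (val2 (pos m) - ?c) =
            (shiftH k + bnd V k) + int (Poly_Mapping.lookup m k)"
          using Adeg_eq_expn(2)[OF deg True] by (simp add: shiftG_def)
        moreover have "0 \<le> shiftH k + bnd V k" using shiftH0 bnd_nonneg by (simp add: add_nonneg_nonneg)
        ultimately show ?thesis
          using True by (simp only: lookup_expo lookup_add \<beta>_def if_True nat_add_distrib of_nat_0_le_iff nat_int)
      next
        case False
        then have "Poly_Mapping.lookup m k = 0" using keys by (auto simp: in_keys_iff)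
        then show ?thesis using False by (simp only: lookup_expo lookup_add \<beta>_def if_False add_0)
      qed
    qed
    then have "E (fst (pos m)) (snd (pos m)) = Poly_Mapping.single (\<beta> + m) (sgnm \<beta> * sgnm m)"
      using Adeg_eq_expn(1)[OF deg] by (simp add: E_def smon_def sgnm_add)
    then have "of_int (Poly_Mapping.lookup P m * sgnm m) * E (fst (pos m)) (snd (pos m)) =
        Poly_Mapping.single (\<beta> + m) (Poly_Mapping.lookup P m * sgnm m * (sgnm \<beta> * sgnm m))"
      by (simp add: mult_single flip: single_of_int)
    \<comment> \<open>The sign built into \<open>smon\<close> cancels the one in
      \<open>comp_poly\<close>.\<close>
    also have "Poly_Mapping.lookup P m * sgnm m * (sgnm \<beta> * sgnm m) = sgnm \<beta> * Poly_Mapping.lookup P m * (sgnm m * sgnm m)"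
      by (simp only: mult_ac)
    also have "Poly_Mapping.single (\<beta> + m) \<dots> =
        of_int (sgnm \<beta>) * (Poly_Mapping.single \<beta> 1 * Poly_Mapping.single m (Poly_Mapping.lookup P m))"
      unfolding sgnm_square by (simp add: mult_single flip: single_of_int)
    finally show "of_int (Poly_Mapping.lookup P m * sgnm m) * E (fst (pos m)) (snd (pos m)) =
        of_int (sgnm \<beta>) * (Poly_Mapping.single \<beta> 1 * Poly_Mapping.single m (Poly_Mapping.lookup P m))" .
  qed
  also have "\<dots> = of_int (sgnm \<beta>) * (Poly_Mapping.single \<beta> 1 *
      (\<Sum>m\<in>?M. Poly_Mapping.single m (Poly_Mapping.lookup P m)))"
    by (simp only: sum_distrib_left)
  finally have lhs: "lin_ext E (comp_poly P m0) = of_int (sgnm \<beta>) * (Poly_Mapping.single \<beta> 1 *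
      (\<Sum>m\<in>?M. Poly_Mapping.single m (Poly_Mapping.lookup P m)))" .
  have "lin_ext E (comp_poly P m0) = (\<Sum>u\<in>supp2 norm_poly. \<Sum>v\<in>supp2 W.
      of_int (coeff (coeff norm_poly (snd u)) (fst u)) * of_int (coeff (coeff W (snd v)) (fst v)) *
      E (fst u + fst v) (snd u + snd v))"
    unfolding W lin_ext_mult by (simp only: split_def)
  also have "\<dots> = (\<Sum>u\<in>supp2 norm_poly. \<Sum>v\<in>S.
      (of_int (coeff (coeff norm_poly (snd u)) (fst u)) * smon (\<lambda>k. shiftH k + expn k (val2 u))) *
      (of_int (coeff (coeff W (snd v)) (fst v)) * smon (\<lambda>k. shiftG k + expn k (val2 v - ?c))))"
  proof (rule sum.cong[OF refl], rule sum.mono_neutral_cong_right[OF finite_supp2])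
    fix u assume u: "u \<in> supp2 norm_poly"
    have split: "val2 (fst u + fst v, snd u + snd v) - ?c = val2 u + (val2 v - ?c)" for v
      by (simp add: val2_def prod_eq_iff)
    have uL: "val2 u \<in> Lam" using supp2_norm_Lam[OF u] .
    show "S \<subseteq> supp2 W" by (auto simp: S_def)
    show "\<forall>v\<in>supp2 W - S. of_int (coeff (coeff norm_poly (snd u)) (fst u)) *
        of_int (coeff (coeff W (snd v)) (fst v)) * E (fst u + fst v) (snd u + snd v) = 0"
    proof
      fix v assume "v \<in> supp2 W - S"
      then have "val2 v - ?c \<notin> Lam" by (simp add: S_def)
      \<comment> \<open>The exponents of the norm lie in \<open>Lam\<close>, so adding one cannot
        move a term into the coset.\<close>
      then have "val2 u + (val2 v - ?c) \<notin> Lam" using Lam_diff[OF _ uL, of "val2 u + (val2 v - ?c)"] by auto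
      then have "E (fst u + fst v) (snd u + snd v) = 0" by (simp only: E_def split if_False)
      then show "of_int (coeff (coeff norm_poly (snd u)) (fst u)) *
        of_int (coeff (coeff W (snd v)) (fst v)) * E (fst u + fst v) (snd u + snd v) = 0" by simp
    qed
    fix v assume v: "v \<in> S"
    then have vL: "val2 v - ?c \<in> Lam" by (simp add: S_def)
    have "E (fst u + fst v) (snd u + snd v) =
        smon (\<lambda>k. (shiftH k + expn k (val2 u)) + (shiftG k + expn k (val2 v - ?c)))"
      using Lam_add[OF uL vL] by (simp add: E_def split expn_add[OF uL vL] add_ac)
    also have "\<dots> = smon (\<lambda>k. shiftH k + expn k (val2 u)) * smon (\<lambda>k. shiftG k + expn k (val2 v - ?c))"
      by (rule smon_mult[symmetric]) (use shiftH_expn[OF u] shiftG[OF v] in auto)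
    finally show "of_int (coeff (coeff norm_poly (snd u)) (fst u)) *
        of_int (coeff (coeff W (snd v)) (fst v)) * E (fst u + fst v) (snd u + snd v) =
      (of_int (coeff (coeff norm_poly (snd u)) (fst u)) * smon (\<lambda>k. shiftH k + expn k (val2 u))) *
      (of_int (coeff (coeff W (snd v)) (fst v)) * smon (\<lambda>k. shiftG k + expn k (val2 v - ?c)))"
      by (simp only: mult_ac)
  qed
  also have "\<dots> = disc_lift * G"
    unfolding disc_lift_def G_def sum_product by (simp add: split_def)
  finally have "disc_lift dvd of_int (sgnm \<beta>) * (Poly_Mapping.single \<beta> 1 *
      (\<Sum>m\<in>?M. Poly_Mapping.single m (Poly_Mapping.lookup P m)))"
    unfolding lhs by (rule dvdI)
  \<comment> \<open>Multiplying by the sign once more removes it, since its square is 1.\<close>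
  then have "disc_lift dvd of_int (sgnm \<beta>) * (of_int (sgnm \<beta>) * (Poly_Mapping.single \<beta> 1 *
      (\<Sum>m\<in>?M. Poly_Mapping.single m (Poly_Mapping.lookup P m))))"
    by (rule dvd_mult)
  moreover have "of_int (sgnm \<beta>) * (of_int (sgnm \<beta>) * x) = x" for x :: "int mpoly"
    by (simp only: mult.assoc[symmetric] of_int_mult[symmetric] sgnm_square of_int_1 mult_1)
  ultimately show ?thesis by (intro exI[of _ \<beta>]) (simp only:)
qed

text \<open>Different summands may need different monomials; multiplying each by the monomial of the
  other gives a common one.\<close>

lemma dvd_monomial_multiple_sum:
  fixes D :: "int mpoly"
  assumes "finite I" "\<And>i. i \<in> I \<Longrightarrow> \<exists>\<beta>. D dvd Poly_Mapping.single \<beta> 1 * f i"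
  shows "\<exists>\<beta>. D dvd Poly_Mapping.single \<beta> 1 * (\<Sum>i\<in>I. f i)"
  using assms
proof (induction I)
  case (insert i I)
  obtain \<beta> \<gamma> where 1: "D dvd Poly_Mapping.single \<beta> 1 * f i"
    and 2: "D dvd Poly_Mapping.single \<gamma> 1 * (\<Sum>i\<in>I. f i)"
    using insert by (meson insertCI)
  have "D dvd Poly_Mapping.single \<gamma> 1 * (Poly_Mapping.single \<beta> 1 * f i) +
      Poly_Mapping.single \<beta> 1 * (Poly_Mapping.single \<gamma> 1 * (\<Sum>i\<in>I. f i))"
    by (rule dvd_add[OF dvd_mult[OF 1] dvd_mult[OF 2]])
  also have "\<dots> = Poly_Mapping.single (\<beta> + \<gamma>) 1 * (\<Sum>i\<in>insert i I. f i)"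
    unfolding sum.insert[OF insert(1,2)] distrib_left mult.assoc[symmetric] mult_single
    by (simp only: add.commute mult_1)
  finally show ?case by blast
qed simp

text \<open>Summing over the A-degrees gives back P, so \<open>disc_lift\<close> divides a monomial
  multiple of P. As P is irreducible and the norm has at least two terms, the numbers of terms
  agree.\<close>

lemma num_terms_vanishing_irreducible:
  assumes vars: "mpoly_vars_in N P" and irr: "irreducible P"
    and van: "\<forall>X\<in>disc_set n N A. mpoly_eval (mpoly_map_int P) X = 0"
  shows "num_terms P \<le> card triangle"
proof -
  have "\<exists>\<beta>. disc_lift dvd Poly_Mapping.single \<beta> 1 *
     (\<Sum>\<alpha>\<in>Adeg ` Poly_Mapping.keys P. \<Sum>m\<in>{m \<in> Poly_Mapping.keys P. Adeg m = \<alpha>}.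
       Poly_Mapping.single m (Poly_Mapping.lookup P m))"
    by (rule dvd_monomial_multiple_sum) (auto intro: disc_lift_dvd_component[OF vars van])
  moreover have "(\<Sum>\<alpha>\<in>Adeg ` Poly_Mapping.keys P. \<Sum>m\<in>{m \<in> Poly_Mapping.keys P. Adeg m = \<alpha>}.
       Poly_Mapping.single m (Poly_Mapping.lookup P m)) = P"
    by (subst sum.image_gen[OF finite_keys, symmetric]) (rule poly_mapping_sum_single[symmetric])
  ultimately obtain \<beta> G where "Poly_Mapping.single \<beta> 1 * P = disc_lift * G"
    by (metis dvdE)
  then have "num_terms P = num_terms disc_lift"
    using num_terms_irreducible_eq[OF irr] num_terms_disc_lift card_supp2_norm_poly by simp
  then show ?thesis using num_terms_disc_lift card_supp2_norm_poly by simp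
qed

end

theorem theorem5p3:
  fixes r :: nat and b :: "nat \<Rightarrow> int \<times> int" and c1 c2 :: "int \<times> int"
    and A :: "nat \<Rightarrow> nat \<Rightarrow> int"
  assumes r: "r \<ge> 1"
    and b_nz: "\<forall>i\<in>{1..r}. b i \<noteq> 0"
    and c_det: "det2 c1 c2 \<noteq> 0"
    and span: "\<forall>v :: int \<times> int. \<exists>(\<mu> :: nat \<Rightarrow> int) \<nu>1 \<nu>2.
                 v = (\<Sum>i=1..r. zsmult2 (\<mu> i) (b i)) + zsmult2 \<nu>1 c1 + zsmult2 \<nu>2 c2"
    and rank: "\<forall>y :: nat \<Rightarrow> rat. (\<forall>k<2*r+3. (\<Sum>i<2*r+1. y i * of_int (A i k)) = 0)
                 \<longrightarrow> (\<forall>i<2*r+1. y i = 0)"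
    and homog: "\<exists>w :: nat \<Rightarrow> rat. \<forall>k<2*r+3. (\<Sum>i<2*r+1. w i * of_int (A i k)) = 1"
    and B_ker: "\<forall>i<2*r+1. \<forall>j<(2::nat). (\<Sum>k<2*r+3. A i k * (if j = 0 then fst (B_row r b c1 c2 k) else snd (B_row r b c1 c2 k))) = 0"
    and B_indep: "\<forall>m n :: int. (\<forall>k<2*r+3. m * fst (B_row r b c1 c2 k) + n * snd (B_row r b c1 c2 k) = 0)
                 \<longrightarrow> m = 0 \<and> n = 0"
    and B_gen: "\<forall>v :: nat \<Rightarrow> int. (\<forall>i<2*r+1. (\<Sum>k<2*r+3. A i k * v k) = 0) \<longrightarrow>
                 (\<exists>m n :: int. \<forall>k<2*r+3. v k = m * fst (B_row r b c1 c2 k) + n * snd (B_row r b c1 c2 k))"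
  shows "real (num_terms (A_discriminant (2*r+1) (2*r+3) A))
           \<le> 5/4 * real_of_int \<bar>det2 c1 c2\<bar> + 7/4"
proof (cases "\<exists>P. is_A_disc_poly (2*r+1) (2*r+3) A P")
  case False
  \<comment> \<open>The default discriminant 1 has one term, and the nonzero determinant has
    absolute value at least 1.\<close>
  have "real (num_terms (A_discriminant (2*r+1) (2*r+3) A)) = 1"
    using False by (simp add: A_discriminant_def num_terms_def)
  moreover have "1 \<le> real_of_int \<bar>det2 c1 c2\<bar>" using c_det by linarith
  ultimately show ?thesis by linarith
next
  case True
  define P where "P = A_discriminant (2*r+1) (2*r+3) A"
  have "P = (SOME P. is_A_disc_poly (2*r+1) (2*r+3) A P)" using True by (simp only: P_def A_discriminant_def if_True)
  then have P: "is_A_disc_poly (2*r+1) (2*r+3) A P" using someI_ex[OF True] by simp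
  have van: "mpoly_eval (mpoly_map_int P) X = 0" if "X \<in> disc_set (2*r+1) (2*r+3) A" for X
  proof -
    \<comment> \<open>The locus lies in its Zariski closure, which is the zero set of
      \<open>P\<close>.\<close>
    have "X \<in> zariski_closure (2*r+3) (disc_set (2*r+1) (2*r+3) A)"
      using that by (auto simp: zariski_closure_def disc_set_def)
    then show ?thesis using P by (auto simp: is_A_disc_poly_def)
  qed
  obtain d g e where dg: "d > 0" "g > 0" "int (d * g) = \<bar>det2 c1 c2\<bar>"
    and Lam: "\<And>v. v \<in> hermite_lattice.Lam d g e \<longleftrightarrow>
       (\<exists>m. v = (fst c1 * fst m + snd c1 * snd m, fst c2 * fst m + snd c2 * snd m))"
    by (rule hermite_normal_form[OF c_det]) blast
  interpret hermite_lattice d g e using dg by unfold_locales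
  interpret cayley_config d g e r b c1 c2 A
    by unfold_locales (fact b_nz c_det homog B_ker B_gen Lam)+
  have "num_terms P \<le> card triangle"
    using P van num_terms_vanishing_irreducible[of P] by (simp add: is_A_disc_poly_def)
  then have "real (num_terms P) \<le> 5/4 * real idx + 7/4" using card_triangle by linarith
  moreover have "real idx = real_of_int \<bar>det2 c1 c2\<bar>" 
    unfolding dg(3)[symmetric] idx_def by simp
  ultimately show ?thesis by (simp only: P_def)
qed

thm_deps theorem5p3

end
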